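(* Let $\nu>0$ and $r,s_1,s_2\ge 0$, let $X_M$ and $X_M^{odd}$ be the Banach spaces defined in the context, and let $(f,u)$ be an approximate solution, with $f>0$ and $u\in X_M^{odd}$, of the equation $f\partial_\theta u+Lu+\tfrac12\partial_x(u^2)=0$, where $L=\nu\partial_x^4+\partial_x^2$, with error $$e=f\partial_\theta u+Lu+\tfrac12\partial_x(u^2).$$ Let $c\in\mathbb{R}$ be such that $S_c=f\partial_\theta+L+c\,\mathrm{Id}$ is invertible, and let $A=\mathrm{Id}+\hat A$, $\tilde e$ and $\tilde N$ be the objects associated with $(f,u)$ and $c$ in the context, where $A$ is a bounded linear operator on $\mathbb{R}\times X_M^{odd}$. Consider the equation $$A z=\tilde e+\tilde N(z),\qquad z=(\sigma,\delta)\in\mathbb{R}\times X_M^{odd}. \qquad ( * )$$ Let $B=\mathrm{Id}+\hat B$ be a bounded linear operator on $\mathbb{R}\times X_M^{odd}$, and suppose that there are real numbers $\alpha,e_1,e_2$ such that A) $\|\hat B\hat A+\hat A+\hat B\|_M=\alpha<1$; B) $\|B\|_M\,\|\tilde e\|_M\le e_1$; C) $\|B\|_M\left(\|S_c^{-1}\partial_\theta\|_M+\tfrac12\|S_c^{-1}\partial_x\|_M\right)\le e_2$; D) $(1-\alpha)^2-4e_1e_2>0$. Then there exists a solution $z_*=(\sigma_*,\delta_* )\in\mathbb{R}\times X_M^{odd}$ of $( * )$ satisfying $$\|z_*\|_M\le E=\frac{e_1}{1-\alpha-\rho_-},\qquad \rho_-=1-\alpha-\sqrt{(1-\alpha)^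2-4e_1e_2}.$$
   Context: Let $\mathbb{T}=\mathbb{R}/2\pi\mathbb{Z}$. The Kuramoto-Sivashinsky equation is $\partial_t u+(\nu\partial_x^4+\partial_x^2)u+\frac12\partial_x(u^2)=0$, $x\in\mathbb{T}$; a $T$-periodic orbit, after rescaling time by $\theta=2\pi t/T$ and setting $f=2\pi/T$, is a pair $(f,u)$ with $u=u(\theta,x)$ on $\mathbb{T}^2$, odd in $x$, solving $f\partial_\theta u+Lu+\frac12\partial_x(u^2)=0$ with $L=\nu\partial_x^4+\partial_x^2$. Spaces. For $r,s_1,s_2\ge0$ put $M(k_1,k_2)=(1+|k_1|)^{s_1}(1+|k_2|)^{s_2}e^{r(|k_1|+|k_2|)}$. $X_M$ is the Banach space of real-valued periodic functions $u(\theta,x)=\sum_{(k_1,k_2)\in\mathbb{Z}^2}u_{k_1,k_2}e^{i(k_1x+k_2\theta)}$ with finite norm $\|u\|_M=\sum_{(k_1,k_2)\in\mathbb{Z}^2}M(k_1,k_2)|u_{k_1,k_2}|$, where for complex numbers the convention $|a+bi|=|a|+|b|$ ($a,b\in\mathbb{R}$) is used. $X_M$ is a Banach algebra under pointwise multiplication. $X_M^{odd}\subset X_M$ is the closed subspace of functions with $u(\theta,-x)=-u(\theta,x)$. On $\mathbb{R}\times X_M^{odd}$ use the norm $\|(\sigma,\delta)\|_M=|\sigma|+\|\delta\|_M$. $\|\cdot\|_M$ of a linear operator denotes its operator norm: on $\mathbb{R}\times X_M^{odd}$ for $\hat A,\hat B,B$, and on $X_M$ for $S_c^{-1}\partial_\theta$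 and $S_c^{-1}\partial_x$. Operators. $S_c=f\partial_\theta+L+c\,\mathrm{Id}$ acts diagonally on Fourier modes: $e^{i(k_1x+k_2\theta)}$ is multiplied by $\nu k_1^4-k_1^2+c+ifk_2$. Invertible means that this number is nonzero for all $(k_1,k_2)\in\mathbb{Z}^2$; then $S_c^{-1}$, $S_c^{-1}\partial_\theta$, $S_c^{-1}\partial_x$, $S_c^{-1}L$ are understood as the corresponding Fourier multipliers (which are bounded on $X_M$). Define, for $(\sigma,\delta)\in\mathbb{R}\times X_M^{odd}$, $$A\begin{pmatrix}\sigma\\ \delta\end{pmatrix}=\begin{pmatrix}\int_{\mathbb{T}^2}\delta\,\partial_\theta u\\ \sigma S_c^{-1}\partial_\theta u+\delta-cS_c^{-1}\delta+S_c^{-1}\partial_x(u\delta)\end{pmatrix},\quad \tilde e=\begin{pmatrix}0\\-S_c^{-1}e\end{pmatrix},\quad \tilde N\begin{pmatrix}\sigma\\ \delta\end{pmatrix}=\begin{pmatrix}0\\-S_c^{-1}\left(\frac12\partial_x(\delta^2)+\sigma\partial_\theta\delta\right)\end{pmatrix},$$ and $\hat A=A-\mathrm{Id}$. If $(\sigma,\delta)$ solves $( * )$, then $(f+\sigma,u+\delta)$ solves the periodic orbit equation and $\int_{\mathbb{T}^2}\delta\,\partial_\theta u=0$. *)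

theory Defs
  imports "HOL-Analysis.Analysis" "HOL-Library.Function_Algebras"
begin

text \<open>Pointwise scalar multiplication; the remaining pointwise operations on functions,
  in particular the product of functions, come from Function_Algebras.\<close>

instantiation "fun" :: (type, real_vector) real_vector
begin
definition scaleR_fun :: "real \<Rightarrow> ('a \<Rightarrow> 'b) \<Rightarrow> 'a \<Rightarrow> 'b"
  where "scaleR_fun a g = (\<lambda>p. a *\<^sub>R g p)"
instance
  by standard (auto simp: scaleR_fun_def fun_eq_iff scaleR_add_right scaleR_add_left)
end

text \<open>A function on the torus is a doubly periodic function of the pair \<open>(\<theta>, x)\<close>.
  A Fourier index is a pair \<open>(k1, k2)\<close> in which \<open>k1\<close> belongs to \<open>x\<close> and
  \<open>k2\<close> to \<open>\<theta>\<close>.  Periodic distributions, such as \<open>\<partial>\<^sub>\<theta> u\<close> or the error \<open>e\<close> for a merely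
  continuous \<open>u\<close>, are represented by their families of Fourier coefficients.\<close>

type_synonym tfun = "real \<times> real \<Rightarrow> real"
type_synonym coeffs = "int \<times> int \<Rightarrow> complex"

definition torus_cell :: "(real \<times> real) set"
  where "torus_cell = cbox (0, 0) (2 * pi, 2 * pi)"

definition mode :: "int \<times> int \<Rightarrow> real \<times> real \<Rightarrow> complex"
  where "mode = (\<lambda>(k1, k2) (\<theta>, x). cis (of_int k1 * x + of_int k2 * \<theta>))"

definition fcoeff :: "tfun \<Rightarrow> coeffs"
  where "fcoeff u k =
    integral torus_cell (\<lambda>p. complex_of_real (u p) * cnj (mode k p)) / complex_of_real ((2 * pi)\<^sup>2)"

text \<open>The sum of a Fourier series.  All series used below satisfy
  \<open>a (- k1, - k2) = cnj (a (k1, k2))\<close>, so their sums are real and \<open>Re\<close> only adjusts the type.\<close>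

definition fourier_sum :: "coeffs \<Rightarrow> tfun"
  where "fourier_sum a p = Re (\<Sum>\<^sub>\<infinity>k. a k * mode k p)"

definition abs1 :: "complex \<Rightarrow> real"
  where "abs1 z = \<bar>Re z\<bar> + \<bar>Im z\<bar>"

definition weight :: "real \<Rightarrow> real \<Rightarrow> real \<Rightarrow> int \<times> int \<Rightarrow> real"
  where "weight r s1 s2 = (\<lambda>(k1, k2).
    (1 + \<bar>of_int k1\<bar>) powr s1 * (1 + \<bar>of_int k2\<bar>) powr s2 * exp (r * (\<bar>of_int k1\<bar> + \<bar>of_int k2\<bar>)))"

definition XM :: "real \<Rightarrow> real \<Rightarrow> real \<Rightarrow> tfun set"
  where "XM r s1 s2 = {u.
    (\<lambda>k. weight r s1 s2 k * abs1 (fcoeff u k)) summable_on UNIV \<and>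
    (\<forall>p. ((\<lambda>k. fcoeff u k * mode k p) has_sum complex_of_real (u p)) UNIV)}"

definition normM :: "real \<Rightarrow> real \<Rightarrow> real \<Rightarrow> tfun \<Rightarrow> real"
  where "normM r s1 s2 u = (\<Sum>\<^sub>\<infinity>k. weight r s1 s2 k * abs1 (fcoeff u k))"

definition XM_odd :: "real \<Rightarrow> real \<Rightarrow> real \<Rightarrow> tfun set"
  where "XM_odd r s1 s2 = {u \<in> XM r s1 s2. \<forall>\<theta> x. u (\<theta>, - x) = - u (\<theta>, x)}"

definition RXM_odd :: "real \<Rightarrow> real \<Rightarrow> real \<Rightarrow> (real \<times> tfun) set"
  where "RXM_odd r s1 s2 = UNIV \<times> XM_odd r s1 s2"

definition pair_normM :: "real \<Rightarrow> real \<Rightarrow> real \<Rightarrow> real \<times> tfun \<Rightarrow> real"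
  where "pair_normM r s1 s2 = (\<lambda>(\<sigma>, \<delta>). \<bar>\<sigma>\<bar> + normM r s1 s2 \<delta>)"

text \<open>Operators on a subspace \<open>V\<close> normed by \<open>N\<close>; their values outside \<open>V\<close> are irrelevant.\<close>

definition bounded_linear_op :: "'a::real_vector set \<Rightarrow> ('a \<Rightarrow> real) \<Rightarrow> ('a \<Rightarrow> 'a) \<Rightarrow> bool"
  where "bounded_linear_op V N T \<longleftrightarrow>
    (\<forall>v\<in>V. T v \<in> V) \<and>
    (\<forall>v\<in>V. \<forall>w\<in>V. T (v + w) = T v + T w) \<and>
    (\<forall>a. \<forall>v\<in>V. T (a *\<^sub>R v) = a *\<^sub>R T v) \<and>
    (\<exists>K. \<forall>v\<in>V. N (T v) \<le> K * N v)"

definition op_norm :: "'a set \<Rightarrow> ('a \<Rightarrow> real) \<Rightarrow> ('a \<Rightarrow> 'a) \<Rightarrow> real"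
  where "op_norm V N T = (SUP v\<in>{v \<in> V. N v \<le> 1}. N (T v))"

definition d_theta :: "coeffs \<Rightarrow> coeffs"
  where "d_theta a = (\<lambda>(k1, k2). \<i> * of_int k2 * a (k1, k2))"

definition d_x :: "coeffs \<Rightarrow> coeffs"
  where "d_x a = (\<lambda>(k1, k2). \<i> * of_int k1 * a (k1, k2))"

definition L_op :: "real \<Rightarrow> coeffs \<Rightarrow> coeffs"
  where "L_op \<nu> a = \<nu> *\<^sub>R d_x (d_x (d_x (d_x a))) + d_x (d_x a)"

definition S_symbol :: "real \<Rightarrow> real \<Rightarrow> real \<Rightarrow> int \<times> int \<Rightarrow> complex"
  where "S_symbol \<nu> f c = (\<lambda>(k1, k2).
    complex_of_real (\<nu> * of_int k1 ^ 4 - of_int k1 ^ 2 + c) + \<i> * complex_of_real (f * of_int k2))"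

definition S_invertible :: "real \<Rightarrow> real \<Rightarrow> real \<Rightarrow> bool"
  where "S_invertible \<nu> f c \<longleftrightarrow> (\<forall>k. S_symbol \<nu> f c k \<noteq> 0)"

definition S_inv :: "real \<Rightarrow> real \<Rightarrow> real \<Rightarrow> coeffs \<Rightarrow> tfun"
  where "S_inv \<nu> f c a = fourier_sum (\<lambda>k. a k / S_symbol \<nu> f c k)"

definition S_inv_d_theta :: "real \<Rightarrow> real \<Rightarrow> real \<Rightarrow> tfun \<Rightarrow> tfun"
  where "S_inv_d_theta \<nu> f c v = S_inv \<nu> f c (d_theta (fcoeff v))"

definition S_inv_d_x :: "real \<Rightarrow> real \<Rightarrow> real \<Rightarrow> tfun \<Rightarrow> tfun"
  where "S_inv_d_x \<nu> f c v = S_inv \<nu> f c (d_x (fcoeff v))"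

text \<open>The integral over the torus of the function \<open>\<delta>\<close> against the distribution with Fourier
  coefficients \<open>a\<close>, obtained by integrating its Fourier series term by term.  It is the ordinary
  integral of the product when the series converges absolutely.  For \<open>a = d_theta (fcoeff u)\<close> the
  series below may diverge if the weight grows slowly, but not if the operator \<open>op_A\<close> below
  is bounded: testing on single modes then gives
  \<open>\<bar>k2\<bar> * norm (fcoeff u (k1, k2)) \<le> K * weight r s1 s2 (k1, k2)\<close>, and this implies
  absolute convergence for all \<open>\<delta>\<close> in \<open>XM_odd r s1 s2\<close>.\<close>

definition torus_pairing :: "tfun \<Rightarrow> coeffs \<Rightarrow> real"
  where "torus_pairing \<delta> a =
    Re (\<Sum>\<^sub>\<infinity>k. integral torus_cell (\<lambda>p. complex_of_real (\<delta> p) * (a k * mode k p)))"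

definition ks_error :: "real \<Rightarrow> real \<Rightarrow> tfun \<Rightarrow> coeffs"
  where "ks_error \<nu> f u =
    f *\<^sub>R d_theta (fcoeff u) + L_op \<nu> (fcoeff u) + (1/2) *\<^sub>R d_x (fcoeff (u * u))"

definition op_A :: "real \<Rightarrow> real \<Rightarrow> real \<Rightarrow> tfun \<Rightarrow> real \<times> tfun \<Rightarrow> real \<times> tfun"
  where "op_A \<nu> f c u = (\<lambda>(\<sigma>, \<delta>).
    (torus_pairing \<delta> (d_theta (fcoeff u)),
     \<sigma> *\<^sub>R S_inv_d_theta \<nu> f c u + \<delta> - c *\<^sub>R S_inv \<nu> f c (fcoeff \<delta>) + S_inv_d_x \<nu> f c (u * \<delta>)))"

definition op_A_hat :: "real \<Rightarrow> real \<Rightarrow> real \<Rightarrow> tfun \<Rightarrow> real \<times> tfun \<Rightarrow> real \<times> tfun"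
  where "op_A_hat \<nu> f c u z = op_A \<nu> f c u z - z"

definition e_tilde :: "real \<Rightarrow> real \<Rightarrow> real \<Rightarrow> tfun \<Rightarrow> real \<times> tfun"
  where "e_tilde \<nu> f c u = (0, - S_inv \<nu> f c (ks_error \<nu> f u))"

definition N_tilde :: "real \<Rightarrow> real \<Rightarrow> real \<Rightarrow> real \<times> tfun \<Rightarrow> real \<times> tfun"
  where "N_tilde \<nu> f c = (\<lambda>(\<sigma>, \<delta>).
    (0, - S_inv \<nu> f c ((1/2) *\<^sub>R d_x (fcoeff (\<delta> * \<delta>)) + \<sigma> *\<^sub>R d_theta (fcoeff \<delta>))))"

end

theory Submission
  imports Defs
begin

text \<open>
  Write \<open>B A = id + R\<close>, where \<open>R\<close> has norm \<open>\<alpha> < 1\<close>.  Applying \<open>B\<close> to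
  \<open>A z = e_tilde + N_tilde z\<close> turns it into the fixed point problem
  \<open>z = B (e_tilde + N_tilde z) - R z\<close>.  Since \<open>N_tilde\<close> is quadratic and \<open>S\<^sub>c\<^sup>-\<^sup>1\<close> absorbs the
  derivatives, \<open>B \<circ> N_tilde\<close> has Lipschitz constant at most \<open>2 e2 x\<close> on the ball of radius \<open>x\<close>.
  Because the discriminant of \<open>e2 x\<^sup>2 - (1 - \<alpha>) x + e1\<close> is positive, the right-hand side is a
  contraction of the ball whose radius is the smaller root, and that root is at most \<open>E\<close>.

  A fixed point satisfies the equation only after \<open>B\<close> has been applied, and the bounds on \<open>B\<close>
  alone do not make it injective: \<open>\<alpha> < 1\<close> makes \<open>B A\<close> invertible, so \<open>A\<close> is injective and \<open>B\<close> is
  onto.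
  What helps is that \<open>A - id\<close> is compact.  The symbols of \<open>S\<^sub>c\<^sup>-\<^sup>1\<close> and \<open>S\<^sub>c\<^sup>-\<^sup>1\<partial>\<^sub>x\<close> tend to zero
  (\<open>symbol_growth\<close>), so after truncation to finitely many modes \<open>A - id\<close> is a finite-rank operator
  plus a contraction (\<open>op_A_fredholm\<close>).  By the Fredholm alternative (\<open>fredholm_alternative\<close>), here
  an argument in finite dimension, the injective operator \<open>A\<close> is onto, and therefore \<open>B\<close> is
  injective.  The abstract theorem \<open>quadratic_newton_kantorovich\<close> combines the two parts.

  For the analysis on the torus everything rests on \<open>fcoeff_unique\<close>: the coefficients of an
  absolutely convergent trigonometric series are the Fourier coefficients of its sum.  It
  identifies the function space with a weighted \<open>\<ell>\<^sup>1\<close> space of Hermitian families, which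
  is complete (\<open>XM_complete\<close>), closed under convolution (\<open>XM_mult\<close>) and under bounded multipliers
  (\<open>multiplier\<close>).\<close>

section \<open>Injectivity and surjectivity in finite dimension\<close>

lemma linear_on_subspace_extend:
  fixes P :: "'a::real_vector \<Rightarrow> 'b::real_vector"
  assumes W: "subspace W"
    and add: "\<And>v w. v \<in> W \<Longrightarrow> w \<in> W \<Longrightarrow> P (v + w) = P v + P w"
    and scale: "\<And>a v. v \<in> W \<Longrightarrow> P (a *\<^sub>R v) = a *\<^sub>R P v"
  shows "\<exists>g. linear g \<and> (\<forall>w\<in>W. g w = P w)"
proof -
  obtain b where b: "b \<subseteq> W" "independent b" "W \<subseteq> span b"
    using maximal_independent_subset by blast
  obtain g where g: "linear g" "\<And>x. x \<in> b \<Longrightarrow> g x = P x"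
    using linear_independent_extend[OF b(2)] by metis
  have P0: "P 0 = 0"
    using scale[of 0 0] subspace_0[OF W] by simp
  have "subspace {w \<in> W. g w = P w}"
    using W g(1) P0 add scale
    by (auto simp: subspace_def linear_0 linear_add linear_scale)
  moreover have "b \<subseteq> {w \<in> W. g w = P w}"
    using b g by auto
  ultimately have "span b \<subseteq> {w \<in> W. g w = P w}"
    by (rule span_minimal[rotated])
  then show ?thesis
    using b(3) g(1) by blast
qed

text \<open>An injective linear map sends a basis of \<open>W\<close> to an independent subset of \<open>W\<close> of the
  same size.  If that subset did not span, it could be enlarged, contradicting the bound on the
  size of independent sets.\<close>

lemma finite_dim_injective_imp_surjective:
  fixes P :: "'a::real_vector \<Rightarrow> 'a"
  assumes W: "subspace W" and S: "finite S" "W \<subseteq> span S"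
    and add: "\<And>v w. v \<in> W \<Longrightarrow> w \<in> W \<Longrightarrow> P (v + w) = P v + P w"
    and scale: "\<And>a v. v \<in> W \<Longrightarrow> P (a *\<^sub>R v) = a *\<^sub>R P v"
    and self: "\<And>w. w \<in> W \<Longrightarrow> P w \<in> W"
    and inj: "\<And>w. w \<in> W \<Longrightarrow> P w = 0 \<Longrightarrow> w = 0"
    and y: "y \<in> W"
  obtains w where "w \<in> W" "P w = y"
proof -
  obtain b where b: "b \<subseteq> W" "independent b" "W \<subseteq> span b"
    using maximal_independent_subset by blast
  obtain g where g: "linear g" "\<And>w. w \<in> W \<Longrightarrow> g w = P w"
    using linear_on_subspace_extend[OF W, of P] add scale by blast
  have span_b: "span b = W"
    using b W by (simp add: span_minimal subset_antisym)
  have finb: "finite b"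
    using independent_span_bound[OF S(1) b(2)] b(1) S(2) by blast
  have inj_g: "inj_on g (span b)"
    unfolding linear_inj_on_span_iff_independent_image[OF g(1)] span_b
  proof (rule inj_onI)
    fix v w assume v: "v \<in> W" and w: "w \<in> W" and eq: "g v = g w"
    have "v - w \<in> W" using W v w by (simp add: subspace_diff)
    moreover have "P (v - w) = 0"
      using g(2)[OF \<open>v - w \<in> W\<close>] eq g(1) by (simp add: linear_diff)
    ultimately have "v - w = 0" by (rule inj)
    then show "v = w" by simp
  qed
  have ind: "independent (g ` b)"
    using linear_independent_injective_image[OF g(1) b(2)] inj_g by simp
  have card: "card (g ` b) = card b"
    using card_image[OF inj_on_subset[OF inj_g span_superset]] .
  have gb: "g ` b \<subseteq> W"
    using b(1) g(2) self by auto
  have "y \<in> span (g ` b)"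
  proof (rule ccontr)
    assume ny: "y \<notin> span (g ` b)"
    then have "independent (insert y (g ` b))"
      using ind by (rule independent_insertI)
    then have "card (insert y (g ` b)) \<le> card b"
      using independent_span_bound[OF finb] gb y span_b by auto
    moreover have "y \<notin> g ` b" using ny span_base[of y "g ` b"] by blast
    ultimately show False using card finb by simp
  qed
  then have "y \<in> g ` span b"
    by (simp add: linear_span_image[OF g(1)])
  then show thesis
    using that g(2) unfolding span_b by auto
qed

section \<open>Complete normed subspaces\<close>

text \<open>The function spaces here depend on real parameters and live inside one type of functions, so
  they are carriers \<open>V\<close> of a norm \<open>N\<close> whose values outside \<open>V\<close> mean nothing.\<close>

locale banach_subspace =
  fixes V :: "'a::real_vector set" and N :: "'a \<Rightarrow> real"
  assumes V_subspace: "subspace V"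
    and norm_triangle: "v \<in> V \<Longrightarrow> w \<in> V \<Longrightarrow> N (v + w) \<le> N v + N w"
    and norm_scale: "v \<in> V \<Longrightarrow> N (a *\<^sub>R v) = \<bar>a\<bar> * N v"
    and definite: "v \<in> V \<Longrightarrow> N v = 0 \<Longrightarrow> v = 0"
    and complete: "(\<And>n. X n \<in> V) \<Longrightarrow>
        (\<And>\<epsilon>. \<epsilon> > 0 \<Longrightarrow> \<exists>M. \<forall>m\<ge>M. \<forall>n\<ge>M. N (X m - X n) < \<epsilon>) \<Longrightarrow>
        \<exists>l\<in>V. (\<lambda>n. N (X n - l)) \<longlonglongrightarrow> 0"
begin

lemma norm_0 [simp]: "N 0 = 0"
  using norm_scale[of 0 0] subspace_0[OF V_subspace] by simp

lemma norm_minus: "v \<in> V \<Longrightarrow> N (- v) = N v"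
  using norm_scale[of v "-1"] by simp

lemma norm_nonneg: "v \<in> V \<Longrightarrow> 0 \<le> N v"
  using norm_triangle[of v "- v"] norm_minus[of v] subspace_neg[OF V_subspace, of v] by simp

lemma norm_diff_commute: "v \<in> V \<Longrightarrow> w \<in> V \<Longrightarrow> N (v - w) = N (w - v)"
  using norm_minus[of "v - w"] subspace_diff[OF V_subspace, of v w] by simp

lemma op_norm_bounds:
  assumes "bounded_linear_op V N T"
  shows "0 \<le> op_norm V N T" and "v \<in> V \<Longrightarrow> N (T v) \<le> op_norm V N T * N v"
proof -
  obtain K where K: "\<And>v. v \<in> V \<Longrightarrow> N (T v) \<le> K * N v"
    and TV: "\<And>v. v \<in> V \<Longrightarrow> T v \<in> V"
    and hom: "\<And>a v. v \<in> V \<Longrightarrow> T (a *\<^sub>R v) = a *\<^sub>R T v"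
    using assms unfolding bounded_linear_op_def by blast
  have "N (T v) \<le> max 0 K" if "v \<in> V" "N v \<le> 1" for v
  proof -
    have "N (T v) \<le> K * N v" using K that by blast
    also have "\<dots> \<le> max 0 K * N v" using norm_nonneg that by (intro mult_right_mono) auto
    also have "\<dots> \<le> max 0 K * 1" using that by (intro mult_left_mono) auto
    finally show ?thesis by simp
  qed
  then have bdd: "bdd_above ((\<lambda>v. N (T v)) ` {v \<in> V. N v \<le> 1})"
    by (intro bdd_aboveI) auto
  have upper: "N (T v) \<le> op_norm V N T" if "v \<in> V" "N v \<le> 1" for v
    unfolding op_norm_def using that by (intro cSUP_upper bdd) auto
  have T0: "T 0 = 0" using hom[of 0 0] subspace_0[OF V_subspace] by simp
  show "0 \<le> op_norm V N T"
    using upper[of 0] subspace_0[OF V_subspace] T0 by simp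
  show "N (T v) \<le> op_norm V N T * N v" if v: "v \<in> V"
  proof (cases "N v = 0")
    case True
    then have "v = 0" using v definite by blast
    then show ?thesis using T0 by simp
  next
    case False
    then have pos: "N v > 0" using norm_nonneg v by (metis less_eq_real_def)
    have "N (T ((1 / N v) *\<^sub>R v)) \<le> op_norm V N T"
      using v pos V_subspace by (intro upper) (auto simp: subspace_scale norm_scale)
    then show ?thesis
      using v pos TV by (simp add: hom norm_scale field_simps)
  qed
qed

text \<open>Banach's theorem on the closed ball of radius \<open>R\<close>, whose completeness follows from that
  of \<open>V\<close>.  The linear equation \<open>x + G x = y\<close> and the nonlinear problem are both solved with
  it.\<close>

lemma contraction_fixpoint:
  assumes R: "0 \<le> R" and q: "q < 1"
    and self: "\<And>v. v \<in> V \<Longrightarrow> N v \<le> R \<Longrightarrow> T v \<in> V \<and> N (T v) \<le> R"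
    and con: "\<And>v w. v \<in> V \<Longrightarrow> w \<in> V \<Longrightarrow> N v \<le> R \<Longrightarrow> N w \<le> R \<Longrightarrow>
      N (T v - T w) \<le> q * N (v - w)"
  obtains v where "v \<in> V" "N v \<le> R" "T v = v"
proof -
  define M where "M = {v \<in> V. N v \<le> R}"
  \<comment> \<open>A metric in the library sense is nonnegative and symmetric on the whole type, hence the cut-off.\<close>
  define d where "d v w = (if v \<in> V \<and> w \<in> V then N (v - w) else 0)" for v w
  have dV: "v - w \<in> V" if "v \<in> V" "w \<in> V" for v w
    using subspace_diff[OF V_subspace that] .
  interpret Metric_space M d
  proof
    show "0 \<le> d x y" for x y
      unfolding d_def using dV norm_nonneg by simp
    show "d x y = d y x" for x y
      unfolding d_def using norm_diff_commute by simp
    show "d x y = 0 \<longleftrightarrow> x = y" if "x \<in> M" "y \<in> M" for x y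
      using that definite[of "x - y"] dV[of x y] by (auto simp: d_def M_def)
    show "d x z \<le> d x y + d y z" if "x \<in> M" "y \<in> M" "z \<in> M" for x y z
      using that norm_triangle[of "x - y" "y - z"] dV[of x y] dV[of y z] by (simp add: d_def M_def)
  qed
  have compl: "mcomplete"
    unfolding mcomplete_def
  proof (intro allI impI)
    fix X assume "MCauchy X"
    then have XM: "\<And>n. X n \<in> M"
      and cauchy: "\<And>\<epsilon>. \<epsilon> > 0 \<Longrightarrow> \<exists>K. \<forall>m\<ge>K. \<forall>n\<ge>K. d (X m) (X n) < \<epsilon>"
      unfolding MCauchy_def by auto
    have XV: "X n \<in> V" for n using XM unfolding M_def by simp
    have "\<exists>K. \<forall>m\<ge>K. \<forall>n\<ge>K. N (X m - X n) < \<epsilon>" if "\<epsilon> > 0" for \<epsilon>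
      using cauchy[OF that] XV by (simp add: d_def)
    from complete[OF XV this] obtain l where l: "l \<in> V" and lim: "(\<lambda>n. N (X n - l)) \<longlonglongrightarrow> 0"
      by blast
    have bound: "N l \<le> R + N (X n - l)" for n
    proof -
      have "N l \<le> N (X n) + N (l - X n)"
        using norm_triangle[OF XV[of n] dV[OF l XV[of n]]] by simp
      then show ?thesis
        using XM[of n] norm_diff_commute[OF l XV[of n]] by (simp add: M_def)
    qed
    have "N l \<le> R"
      using tendsto_lowerbound[OF tendsto_add[OF tendsto_const lim] always_eventually[OF allI[OF bound]]]
      by simp
    then have "l \<in> M" using l by (simp add: M_def)
    then have "limitin mtopology X l sequentially"
      using lim XM XV l by (simp add: limitin_metric_dist_null d_def)
    then show "\<exists>x. limitin mtopology X x sequentially" by blast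
  qed
  have "M \<noteq> {}" using R subspace_0[OF V_subspace] by (auto simp: M_def)
  moreover have "T \<in> M \<rightarrow> M" using self by (auto simp: M_def)
  moreover have "d (T x) (T y) \<le> q * d x y" if "x \<in> M" "y \<in> M" for x y
    using that self con by (simp add: d_def M_def)
  ultimately obtain x where "x \<in> M" "T x = x"
    using Banach_fixedpoint_thm[OF compl, of T q] q by blast
  then show thesis using that[of x] by (simp add: M_def)
qed

lemma bounded_linear_op_minus_id:
  assumes T: "bounded_linear_op V N T"
  shows "bounded_linear_op V N (\<lambda>v. T v - v)"
proof -
  obtain K where K: "\<And>v. v \<in> V \<Longrightarrow> N (T v) \<le> K * N v"
    and TV: "\<And>v. v \<in> V \<Longrightarrow> T v \<in> V"
    using T unfolding bounded_linear_op_def by blast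
  have "N (T v - v) \<le> (K + 1) * N v" if "v \<in> V" for v
    using norm_triangle[of "T v" "- v"] that K[OF that] TV norm_minus subspace_neg[OF V_subspace]
    by (simp add: algebra_simps)
  then have "\<exists>K. \<forall>v\<in>V. N (T v - v) \<le> K * N v" by blast
  then show ?thesis
    using T subspace_diff[OF V_subspace] unfolding bounded_linear_op_def
    by (auto simp: algebra_simps)
qed

lemma bounded_linear_op_compose:
  assumes S: "bounded_linear_op V N S" and T: "bounded_linear_op V N T"
  shows "bounded_linear_op V N (\<lambda>v. S (T v))"
proof -
  have TV: "T v \<in> V" if "v \<in> V" for v
    using T that unfolding bounded_linear_op_def by blast
  have "N (S (T v)) \<le> (op_norm V N S * op_norm V N T) * N v" if v: "v \<in> V" for v
  proof -
    have "N (S (T v)) \<le> op_norm V N S * N (T v)"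
      using op_norm_bounds(2)[OF S TV[OF v]] .
    also have "\<dots> \<le> op_norm V N S * (op_norm V N T * N v)"
      using op_norm_bounds(1)[OF S] op_norm_bounds(2)[OF T v] by (rule mult_left_mono[rotated])
    finally show ?thesis by (simp add: mult.assoc)
  qed
  then have "\<exists>K. \<forall>v\<in>V. N (S (T v)) \<le> K * N v" by blast
  then show ?thesis
    using S T unfolding bounded_linear_op_def by simp
qed

lemma identity_plus_contraction_onto:
  assumes GV: "\<And>v. v \<in> V \<Longrightarrow> G v \<in> V"
    and add: "\<And>v w. v \<in> V \<Longrightarrow> w \<in> V \<Longrightarrow> G (v + w) = G v + G w"
    and hom: "\<And>a v. v \<in> V \<Longrightarrow> G (a *\<^sub>R v) = a *\<^sub>R G v"
    and small: "\<And>v. v \<in> V \<Longrightarrow> N (G v) \<le> q * N v"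
    and q: "0 \<le> q" "q < 1" and y: "y \<in> V"
  shows "\<exists>x\<in>V. x + G x = y"
proof -
  define R where "R = N y / (1 - q)"
  have R0: "0 \<le> R" using q norm_nonneg[OF y] by (simp add: R_def)
  have R: "N y + q * R = R" using q by (simp add: R_def field_simps)
  have dV: "v - w \<in> V" if "v \<in> V" "w \<in> V" for v w
    using subspace_diff[OF V_subspace that] .
  have G_diff: "G (v - w) = G v - G w" if "v \<in> V" "w \<in> V" for v w
    using add[of v "(-1) *\<^sub>R w"] hom[of w "-1"] subspace_scale[OF V_subspace, of w "-1"] that by simp
  obtain x where x: "x \<in> V" "y - G x = x"
  proof (rule contraction_fixpoint[OF R0 q(2), of "\<lambda>x. y - G x"])
    fix v assume v: "v \<in> V" "N v \<le> R"
    have "N (y - G v) \<le> N y + N (G v)"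
      using norm_triangle[OF y subspace_neg[OF V_subspace GV[OF v(1)]]] norm_minus[OF GV[OF v(1)]]
      by simp
    also have "\<dots> \<le> N y + q * R"
      using small[OF v(1)] mult_left_mono[OF v(2) q(1)] by simp
    finally show "y - G v \<in> V \<and> N (y - G v) \<le> R"
      using dV[OF y GV[OF v(1)]] R by simp
  next
    fix v w assume v: "v \<in> V" and w: "w \<in> V"
    have "y - G v - (y - G w) = G (w - v)" using G_diff[OF w v] by simp
    then show "N (y - G v - (y - G w)) \<le> q * N (v - w)"
      using small[OF dV[OF w v]] norm_diff_commute[OF v w] by simp
  qed blast
  have "x + G x = y" using x(2) by (metis diff_add_cancel)
  then show ?thesis using x(1) by blast
qed

text \<open>The Fredholm alternative for a finite-rank perturbation of \<open>J = id + G\<close> with a contraction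
  \<open>G\<close>.  If \<open>H\<close> is the inverse of \<open>J\<close>, then \<open>A \<circ> H\<close> differs from the identity by a map into a
  finite-dimensional space \<open>W\<close>.  So \<open>A \<circ> H\<close> maps \<open>W\<close> injectively into itself, hence onto
  itself, and for any \<open>y\<close> the defect \<open>A (H y) - y \<in> W\<close> can be corrected by an element of \<open>W\<close>.\<close>

lemma fredholm_alternative:
  assumes AV: "\<And>v. v \<in> V \<Longrightarrow> A v \<in> V"
    and A_add: "\<And>v w. v \<in> V \<Longrightarrow> w \<in> V \<Longrightarrow> A (v + w) = A v + A w"
    and A_hom: "\<And>a v. v \<in> V \<Longrightarrow> A (a *\<^sub>R v) = a *\<^sub>R A v"
    and GV: "\<And>v. v \<in> V \<Longrightarrow> G v \<in> V"
    and G_add: "\<And>v w. v \<in> V \<Longrightarrow> w \<in> V \<Longrightarrow> G (v + w) = G v + G w"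
    and G_hom: "\<And>a v. v \<in> V \<Longrightarrow> G (a *\<^sub>R v) = a *\<^sub>R G v"
    and small: "\<And>v. v \<in> V \<Longrightarrow> N (G v) \<le> q * N v" and q: "0 \<le> q" "q < 1"
    and S: "finite S" and finite_rank: "\<And>v. v \<in> V \<Longrightarrow> A v - v - G v \<in> span S"
    and inj: "\<And>v. v \<in> V \<Longrightarrow> A v = 0 \<Longrightarrow> v = 0" and y: "y \<in> V"
  shows "\<exists>x\<in>V. A x = y"
proof -
  define J where "J v = v + G v" for v
  define W where "W = V \<inter> span S"
  have aV: "v + w \<in> V" and dV: "v - w \<in> V" if "v \<in> V" "w \<in> V" for v w
    using that V_subspace by (auto intro: subspace_add subspace_diff)
  have sV: "a *\<^sub>R v \<in> V" if "v \<in> V" for a v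
    using subspace_scale[OF V_subspace that] .
  have J_add: "J (v + w) = J v + J w" if "v \<in> V" "w \<in> V" for v w
    unfolding J_def using G_add[OF that] by simp
  have J_hom: "J (a *\<^sub>R v) = a *\<^sub>R J v" if "v \<in> V" for a v
    unfolding J_def using G_hom[OF that] by (simp add: scaleR_add_right)
  have J_inj: "v = w" if vw: "v \<in> V" "w \<in> V" and eq: "J v = J w" for v w
  proof -
    have d: "v - w \<in> V" using dV vw .
    have "J (v - w) = 0"
      using J_add[OF vw(1) sV[OF vw(2)], of "-1"] J_hom[OF vw(2), of "-1"] eq by simp
    then have "v - w = - G (v - w)" by (simp add: J_def eq_neg_iff_add_eq_0)
    then have "N (v - w) \<le> q * N (v - w)"
      using small[OF d] norm_minus[OF GV[OF d]] by metis
    moreover have "0 \<le> N (v - w)" using norm_nonneg[OF d] .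
    moreover have "N (v - w) \<le> 0"
      using calculation q(2) mult_le_0_iff[of "1 - q" "N (v - w)"] by (simp add: left_diff_distrib)
    ultimately have "N (v - w) = 0" by simp
    then show ?thesis using definite[OF d] by simp
  qed
  obtain H where H: "\<And>v. v \<in> V \<Longrightarrow> H v \<in> V" "\<And>v. v \<in> V \<Longrightarrow> J (H v) = v"
    using identity_plus_contraction_onto[OF GV G_add G_hom small q] unfolding J_def by metis
  have H_add: "H (v + w) = H v + H w" if "v \<in> V" "w \<in> V" for v w
    by (rule J_inj) (simp_all add: that H aV J_add)
  have H_hom: "H (a *\<^sub>R v) = a *\<^sub>R H v" if "v \<in> V" for a v
    by (rule J_inj) (simp_all add: that H sV J_hom)
  have AH: "A (H v) - v \<in> W" if v: "v \<in> V" for v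
  proof -
    have "A (H v) - v = A (H v) - H v - G (H v)"
      using H(2)[OF v] unfolding J_def by (metis diff_diff_eq)
    with finite_rank[OF H(1)[OF v]] have "A (H v) - v \<in> span S" by metis
    then show ?thesis
      using dV[OF AV[OF H(1)[OF v]] v] by (simp add: W_def)
  qed
  have W: "subspace W" unfolding W_def using V_subspace by (simp add: subspace_inter)
  have WV: "w \<in> V" if "w \<in> W" for w using that by (simp add: W_def)
  have "\<exists>w\<in>W. A (H w) = A (H y) - y"
  proof -
    obtain w where "w \<in> W" "A (H w) = A (H y) - y"
    proof (rule finite_dim_injective_imp_surjective[OF W S, of "\<lambda>w. A (H w)"])
      show "W \<subseteq> span S" by (simp add: W_def)
      show "A (H (v + w)) = A (H v) + A (H w)" if "v \<in> W" "w \<in> W" for v w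
        using that WV H H_add A_add by simp
      show "A (H (a *\<^sub>R v)) = a *\<^sub>R A (H v)" if "v \<in> W" for a v
        using that WV H H_hom A_hom by simp
      show "A (H w) \<in> W" if "w \<in> W" for w
        using subspace_add[OF W AH[OF WV[OF that]] that] by simp
      show "w = 0" if w: "w \<in> W" and "A (H w) = 0" for w
      proof -
        have "H w = 0" using inj[OF H(1)[OF WV[OF w]]] that(2) .
        moreover have "J 0 = 0" using J_hom[OF subspace_0[OF V_subspace], of 0] by simp
        ultimately show ?thesis using H(2)[OF WV[OF w]] by simp
      qed
      show "A (H y) - y \<in> W" using AH[OF y] .
    qed blast
    then show ?thesis by blast
  qed
  then obtain w where w: "w \<in> W" "A (H w) = A (H y) - y" by blast
  have Hw: "H w \<in> V" and Hy: "H y \<in> V" using H(1) WV[OF w(1)] y by auto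
  have "A (H y - H w) = A (H y) - A (H w)"
    using A_add[OF Hy sV[OF Hw], of "-1"] A_hom[OF Hw, of "-1"] by simp
  then have "A (H y - H w) = y" using w(2) by simp
  then show ?thesis using dV[OF Hy Hw] by blast
qed

text \<open>The map \<open>T v = B (y + Q v) - (B A - id) v\<close> is a contraction of the ball whose radius \<open>x\<close> is
  the smaller root of \<open>e2 x\<^sup>2 - (1 - \<alpha>) x + e1\<close> (the only root if \<open>e2 = 0\<close>).  With \<open>d\<close> the square
  root of the discriminant, its Lipschitz constant there is \<open>\<alpha> + 2 e2 x = 1 - d\<close>, and
  \<open>x \<le> e1 / d\<close> because \<open>d \<le> 1 - \<alpha>\<close>.

  The fixed point solves \<open>B (A v) = B (y + Q v)\<close>, and \<open>B\<close> has to be cancelled.  The bound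
  \<open>\<alpha> < 1\<close> only makes \<open>B A\<close> injective, that is, \<open>B\<close> injective on the range of \<open>A\<close>.  But then \<open>A\<close>
  is injective, hence onto by the hypothesis \<open>fredholm\<close>, so \<open>B\<close> is injective on all of \<open>V\<close>.\<close>

lemma quadratic_newton_kantorovich:
  assumes A: "bounded_linear_op V N A" and B: "bounded_linear_op V N B"
    and fredholm: "(\<And>v. v \<in> V \<Longrightarrow> A v = 0 \<Longrightarrow> v = 0) \<Longrightarrow> (\<And>y. y \<in> V \<Longrightarrow> \<exists>x\<in>V. A x = y)"
    and \<alpha>: "op_norm V N (\<lambda>v. B (A v) - v) = \<alpha>" "\<alpha> < 1"
    and y: "y \<in> V"
    and QV: "\<And>v. v \<in> V \<Longrightarrow> Q v \<in> V" and Q0: "Q 0 = 0"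
    and Q_lip: "\<And>v w. v \<in> V \<Longrightarrow> w \<in> V \<Longrightarrow> N (Q v - Q w) \<le> K * (N v + N w) * N (v - w)"
    and K: "0 \<le> K"
    and e1: "op_norm V N B * N y \<le> e1" and e2: "op_norm V N B * K \<le> e2"
    and D: "(1 - \<alpha>)\<^sup>2 - 4 * e1 * e2 > 0"
  shows "\<exists>v\<in>V. A v = y + Q v \<and> N v \<le> e1 / sqrt ((1 - \<alpha>)\<^sup>2 - 4 * e1 * e2)"
proof -
  define R where "R v = B (A v) - v" for v
  define d where "d = sqrt ((1 - \<alpha>)\<^sup>2 - 4 * e1 * e2)"
  \<comment> \<open>The rationalised form of the root makes sense also for \<open>e2 = 0\<close>.\<close>
  define x where "x = 2 * e1 / (1 - \<alpha> + d)"
  let ?b = "op_norm V N B"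
  have R: "bounded_linear_op V N R"
    unfolding R_def by (rule bounded_linear_op_minus_id[OF bounded_linear_op_compose[OF B A]])
  have opR: "op_norm V N R = \<alpha>" using \<alpha>(1) by (simp add: R_def[abs_def])
  have a0: "0 \<le> \<alpha>" using op_norm_bounds(1)[OF R] opR by simp
  have R_le: "N (R v) \<le> \<alpha> * N v" if "v \<in> V" for v
    using op_norm_bounds(2)[OF R that] opR by simp
  have b0: "0 \<le> ?b" and B_le: "\<And>v. v \<in> V \<Longrightarrow> N (B v) \<le> ?b * N v"
    using op_norm_bounds[OF B] by auto
  have lin: "T v \<in> V" "T (v - w) = T v - T w"
    if T: "bounded_linear_op V N T" and v: "v \<in> V" and w: "w \<in> V" for T v w
  proof -
    show "T v \<in> V" using T v unfolding bounded_linear_op_def by blast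
    have "T (v + (-1) *\<^sub>R w) = T v + (-1) *\<^sub>R T w"
      using T v w subspace_scale[OF V_subspace w, of "-1"] unfolding bounded_linear_op_def by metis
    then show "T (v - w) = T v - T w" by simp
  qed
  have aV: "v + w \<in> V" and dV: "v - w \<in> V" if "v \<in> V" "w \<in> V" for v w
    using that V_subspace by (auto intro: subspace_add subspace_diff)
  have e10: "0 \<le> e1" using order_trans[OF mult_nonneg_nonneg[OF b0 norm_nonneg[OF y]] e1] .
  have e20: "0 \<le> e2" using order_trans[OF mult_nonneg_nonneg[OF b0 K] e2] .
  have d0: "0 < d" using D by (simp add: d_def)
  have d2: "d\<^sup>2 = (1 - \<alpha>)\<^sup>2 - 4 * e1 * e2" using D by (simp add: d_def)
  have "d\<^sup>2 \<le> (1 - \<alpha>)\<^sup>2" using d2 mult_nonneg_nonneg[OF e10 e20] by simp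
  then have d_le: "d \<le> 1 - \<alpha>" using power2_le_imp_le[of d "1 - \<alpha>"] \<alpha>(2) by simp
  have x0: "0 \<le> x" using e10 d0 \<alpha>(2) by (simp add: x_def)
  have x_le: "x \<le> e1 / d"
  proof -
    have "x \<le> 2 * e1 / (2 * d)"
      unfolding x_def using e10 d0 d_le by (intro divide_left_mono) auto
    then show ?thesis by simp
  qed
  have x_lin: "2 * e2 * x = 1 - \<alpha> - d"
  proof -
    have "(1 - \<alpha> + d) * (1 - \<alpha> - d) = 4 * e1 * e2"
      using d2 by (simp add: power2_eq_square algebra_simps)
    then show ?thesis unfolding x_def using d0 \<alpha>(2) by (simp add: field_simps)
  qed
  have x_root: "e1 + e2 * x * x + \<alpha> * x = x"
  proof -
    have "2 * e1 = x * (1 - \<alpha> + d)" unfolding x_def using d0 \<alpha>(2) by simp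
    moreover have "2 * (e2 * x * x) = x * (1 - \<alpha> - d)"
      using x_lin by (metis mult.assoc mult.commute)
    ultimately show ?thesis by (simp add: algebra_simps)
  qed
  define T where "T v = B (y + Q v) - R v" for v
  obtain v where v: "v \<in> V" "N v \<le> x" "T v = v"
  proof (rule contraction_fixpoint[OF x0, of "1 - d" T])
    show "1 - d < 1" using d0 by simp
    fix v assume v: "v \<in> V" "N v \<le> x"
    have BQ: "B (y + Q v) \<in> V" "R v \<in> V" "Q v \<in> V"
      using lin(1)[OF B aV[OF y QV[OF v(1)]] y] lin(1)[OF R v(1) v(1)] QV[OF v(1)] by simp_all
    have TV: "T v \<in> V" unfolding T_def using dV[OF BQ(1) BQ(2)] .
    have nx: "0 \<le> N v" using norm_nonneg[OF v(1)] .
    have "N (Q v) \<le> K * (N v * N v)"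
      using Q_lip[OF v(1) subspace_0[OF V_subspace]] Q0 by (simp add: mult.assoc)
    also have "\<dots> \<le> K * (x * x)" using v(2) nx K by (intro mult_left_mono mult_mono) auto
    finally have NQ: "N (Q v) \<le> K * (x * x)" .
    have "N (T v) \<le> N (B (y + Q v)) + N (R v)"
      unfolding T_def using norm_triangle[OF BQ(1) subspace_neg[OF V_subspace BQ(2)]]
        norm_minus[OF BQ(2)] by simp
    also have "N (B (y + Q v)) \<le> ?b * (N y + K * (x * x))"
    proof -
      have "N (B (y + Q v)) \<le> ?b * N (y + Q v)" using B_le[OF aV[OF y BQ(3)]] .
      also have "\<dots> \<le> ?b * (N y + K * (x * x))"
        using norm_triangle[OF y BQ(3)] NQ b0 by (intro mult_left_mono) auto
      finally show ?thesis .
    qed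
    also have "?b * (N y + K * (x * x)) = ?b * N y + (?b * K) * (x * x)"
      by (simp add: algebra_simps)
    also have "\<dots> \<le> e1 + e2 * (x * x)"
      using e1 mult_right_mono[OF e2, of "x * x"] by simp
    also have "N (R v) \<le> \<alpha> * x" using R_le[OF v(1)] mult_left_mono[OF v(2) a0] by simp
    finally have "N (T v) \<le> x" using x_root by (simp add: mult.assoc)
    then show "T v \<in> V \<and> N (T v) \<le> x" using TV by blast
  next
    fix v w assume v: "v \<in> V" "N v \<le> x" and w: "w \<in> V" "N w \<le> x"
    have q: "Q v \<in> V" "Q w \<in> V" "Q v - Q w \<in> V" using QV[OF v(1)] QV[OF w(1)] dV[OF QV[OF v(1)] QV[OF w(1)]] by simp_all
    have vw: "v - w \<in> V" using dV[OF v(1) w(1)] .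
    have n0: "0 \<le> N (v - w)" using norm_nonneg[OF vw] .
    have BV: "B (Q v - Q w) \<in> V" and RV: "R (v - w) \<in> V"
      using lin(1)[OF B q(3) q(3)] lin(1)[OF R vw vw] by auto
    have "T v - T w = B (Q v - Q w) - R (v - w)"
      unfolding T_def using lin(2)[OF B aV[OF y q(1)] aV[OF y q(2)]] lin(2)[OF R v(1) w(1)]
      by simp
    then have "N (T v - T w) \<le> N (B (Q v - Q w)) + N (R (v - w))"
      using norm_triangle[OF BV subspace_neg[OF V_subspace RV]] norm_minus[OF RV] by simp
    also have "N (B (Q v - Q w)) \<le> ?b * (K * (2 * x) * N (v - w))"
    proof -
      have "N (Q v - Q w) \<le> K * (N v + N w) * N (v - w)" using Q_lip[OF v(1) w(1)] .
      also have "\<dots> \<le> K * (2 * x) * N (v - w)"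
        using v(2) w(2) K n0 by (intro mult_right_mono mult_left_mono) auto
      finally show ?thesis using order_trans[OF B_le[OF q(3)] mult_left_mono[OF _ b0]] by simp
    qed
    also have "?b * (K * (2 * x) * N (v - w)) = (?b * K) * (2 * x * N (v - w))"
      by simp
    also have "\<dots> \<le> e2 * (2 * x * N (v - w))"
      using e2 x0 n0 by (intro mult_right_mono) auto
    also have "N (R (v - w)) \<le> \<alpha> * N (v - w)" using R_le[OF vw] .
    finally have "N (T v - T w) \<le> (2 * e2 * x + \<alpha>) * N (v - w)"
      by (simp add: algebra_simps)
    then show "N (T v - T w) \<le> (1 - d) * N (v - w)" using x_lin by simp
  qed blast
  have BA_inj: "v = 0" if v: "v \<in> V" and "B (A v) = 0" for v
  proof -
    have "R v = - v" using that(2) by (simp add: R_def)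
    then have "N v \<le> \<alpha> * N v" using R_le[OF v] norm_minus[OF v] by simp
    then have "(1 - \<alpha>) * N v \<le> 0" by (simp add: algebra_simps)
    then have "N v \<le> 0" using \<alpha>(2) by (simp add: mult_le_0_iff)
    then show "v = 0" using definite[OF v] norm_nonneg[OF v] by simp
  qed
  have B0: "B 0 = 0"
    using lin(2)[OF B v(1) v(1)] by simp
  have A_inj: "v = 0" if "v \<in> V" "A v = 0" for v
    using BA_inj[OF that(1)] that(2) B0 by simp
  have yQ: "y + Q v \<in> V" using aV[OF y QV[OF v(1)]] .
  have Av: "A v \<in> V" using lin(1)[OF A v(1) v(1)] .
  have "B (A v) = B (y + Q v)" using v(3) by (simp add: T_def R_def)
  then have "B (A v - (y + Q v)) = 0" using lin(2)[OF B Av yQ] by simp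
  moreover obtain z where z: "z \<in> V" "A z = A v - (y + Q v)"
    using fredholm[OF A_inj dV[OF Av yQ]] by blast
  ultimately have "z = 0" using BA_inj[OF z(1)] by simp
  then have "A v = y + Q v"
    using z(2) lin(2)[OF A v(1) v(1)] by simp
  moreover have "N v \<le> e1 / d" using v(2) x_le by simp
  ultimately show ?thesis using v(1) unfolding d_def by blast
qed

end

lemma banach_subspace_pair:
  assumes "banach_subspace V N"
  shows "banach_subspace (UNIV \<times> V) (\<lambda>(a, v). \<bar>a\<bar> + N v)"
proof -
  interpret banach_subspace V N by (rule assms)
  have dV: "v - w \<in> V" if "v \<in> V" "w \<in> V" for v w
    using subspace_diff[OF V_subspace that] .
  let ?N = "\<lambda>(a :: real, v). \<bar>a\<bar> + N v"
  show ?thesis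
  proof
    show "subspace ((UNIV :: real set) \<times> V)"
      using V_subspace by (auto simp: subspace_def zero_prod_def)
    show "?N (z + z') \<le> ?N z + ?N z'" if "z \<in> UNIV \<times> V" "z' \<in> UNIV \<times> V" for z z'
      using that norm_triangle[of "snd z" "snd z'"] by (cases z; cases z') auto
    show "?N (c *\<^sub>R z) = \<bar>c\<bar> * ?N z" if "z \<in> UNIV \<times> V" for c z
      using that norm_scale[of "snd z" c] by (cases z) (auto simp: abs_mult distrib_left)
    show "z = 0" if "z \<in> UNIV \<times> V" "?N z = 0" for z
      using that norm_nonneg[of "snd z"] definite[of "snd z"]
      by (cases z) (auto simp: zero_prod_def add_nonneg_eq_0_iff)
    fix X :: "nat \<Rightarrow> real \<times> 'a"
    assume X: "\<And>n. X n \<in> UNIV \<times> V"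
      and cauchy: "\<And>\<epsilon>. \<epsilon> > 0 \<Longrightarrow> \<exists>M. \<forall>m\<ge>M. \<forall>n\<ge>M. ?N (X m - X n) < \<epsilon>"
    have V: "snd (X n) \<in> V" for n using X[of n] by (simp add: mem_Times_iff)
    have N_eq: "?N (X m - X n) = \<bar>fst (X m) - fst (X n)\<bar> + N (snd (X m) - snd (X n))" for m n
      by (simp add: split_beta)
    have "\<exists>l\<in>V. (\<lambda>n. N (snd (X n) - l)) \<longlonglongrightarrow> 0"
    proof (rule complete[OF V])
      fix \<epsilon> :: real assume "\<epsilon> > 0"
      then obtain M where M: "\<And>m n. m \<ge> M \<Longrightarrow> n \<ge> M \<Longrightarrow> ?N (X m - X n) < \<epsilon>" using cauchy by blast
      have "N (snd (X m) - snd (X n)) < \<epsilon>" if "m \<ge> M" "n \<ge> M" for m n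
        using M[OF that] N_eq[of m n] by simp
      then show "\<exists>M. \<forall>m\<ge>M. \<forall>n\<ge>M. N (snd (X m) - snd (X n)) < \<epsilon>" by blast
    qed
    then obtain l where l: "l \<in> V" "(\<lambda>n. N (snd (X n) - l)) \<longlonglongrightarrow> 0" by blast
    have "Cauchy (\<lambda>n. fst (X n))"
    proof (rule metric_CauchyI)
      fix \<epsilon> :: real assume "\<epsilon> > 0"
      then obtain M where M: "\<And>m n. m \<ge> M \<Longrightarrow> n \<ge> M \<Longrightarrow> ?N (X m - X n) < \<epsilon>" using cauchy by blast
      have "dist (fst (X m)) (fst (X n)) < \<epsilon>" if "m \<ge> M" "n \<ge> M" for m n
        using M[OF that] N_eq[of m n] norm_nonneg[OF dV[OF V[of m] V[of n]]] by (simp add: dist_real_def)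
      then show "\<exists>M. \<forall>m\<ge>M. \<forall>n\<ge>M. dist (fst (X m)) (fst (X n)) < \<epsilon>" by blast
    qed
    then obtain a where a: "(\<lambda>n. fst (X n)) \<longlonglongrightarrow> a"
      using Cauchy_convergent_iff convergent_def by blast
    have "(\<lambda>n. \<bar>fst (X n) - a\<bar> + N (snd (X n) - l)) \<longlonglongrightarrow> \<bar>a - a\<bar> + 0"
      by (intro tendsto_add tendsto_rabs tendsto_diff a tendsto_const l(2))
    then have "(\<lambda>n. ?N (X n - (a, l))) \<longlonglongrightarrow> 0" by (simp add: split_beta)
    then show "\<exists>l\<in>UNIV \<times> V. (\<lambda>n. ?N (X n - l)) \<longlonglongrightarrow> 0"
      using l(1) by blast
  qed
qed

section \<open>The modulus, the weight and the modes\<close>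

lemma abs1_nonneg [simp]: "0 \<le> abs1 z"
  by (simp add: abs1_def)

lemma abs1_0 [simp]: "abs1 0 = 0"
  by (simp add: abs1_def)

lemma abs1_eq_0_iff [simp]: "abs1 z = 0 \<longleftrightarrow> z = 0"
  by (auto simp: abs1_def complex_eq_iff)

lemma abs1_triangle: "abs1 (z + z') \<le> abs1 z + abs1 z'"
  by (simp add: abs1_def)

lemma abs1_scaleR [simp]: "abs1 (a *\<^sub>R z) = \<bar>a\<bar> * abs1 z"
  by (simp add: abs1_def abs_mult distrib_left)

lemma abs1_mult_le: "abs1 (z * z') \<le> abs1 z * abs1 z'"
proof -
  have "\<bar>Re z * Re z' - Im z * Im z'\<bar> \<le> \<bar>Re z\<bar> * \<bar>Re z'\<bar> + \<bar>Im z\<bar> * \<bar>Im z'\<bar>"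
    by (metis abs_mult abs_triangle_ineq4)
  moreover have "\<bar>Re z * Im z' + Im z * Re z'\<bar> \<le> \<bar>Re z\<bar> * \<bar>Im z'\<bar> + \<bar>Im z\<bar> * \<bar>Re z'\<bar>"
    by (metis abs_mult abs_triangle_ineq)
  ultimately show ?thesis
    by (simp add: abs1_def algebra_simps)
qed

lemma cmod_le_abs1: "cmod z \<le> abs1 z"
  by (simp add: abs1_def cmod_le)

lemma abs1_le_cmod: "abs1 z \<le> 2 * cmod z"
  using abs_Re_le_cmod[of z] abs_Im_le_cmod[of z] by (simp add: abs1_def)

lemma tendsto_abs1: "(f \<longlongrightarrow> z) F \<Longrightarrow> ((\<lambda>x. abs1 (f x)) \<longlongrightarrow> abs1 z) F"
  unfolding abs1_def by (intro tendsto_intros)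

lemma mode_plus: "mode (k + l) p = mode k p * mode l p"
  by (cases k; cases l; cases p) (simp add: mode_def cis_mult algebra_simps)

lemma mode_minus: "mode (- k) p = cnj (mode k p)"
  by (cases k; cases p) (auto simp: mode_def cis_cnj intro!: arg_cong[of _ _ cis])

lemma norm_mode [simp]: "cmod (mode k p) = 1"
  by (cases k; cases p) (simp add: mode_def)

lemma continuous_on_mode: "continuous_on A (mode k)"
  by (cases k) (auto simp: mode_def split_beta intro!: continuous_intros)

lemma abs1_has_sum_le:
  assumes f: "(f has_sum S) A" and g: "(g has_sum T) A"
    and le: "\<And>x. x \<in> A \<Longrightarrow> abs1 (f x) \<le> g x"
  shows "abs1 S \<le> T"
proof (rule tendsto_le)
  show "((\<lambda>F. abs1 (sum f F)) \<longlongrightarrow> abs1 S) (finite_subsets_at_top A)"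
    using f unfolding has_sum_def by (rule tendsto_abs1)
  show "(sum g \<longlongrightarrow> T) (finite_subsets_at_top A)"
    using g unfolding has_sum_def .
  have "abs1 (sum f F) \<le> sum g F" if "finite F" "F \<subseteq> A" for F
    using that
  proof (induction F rule: finite_induct)
    case (insert x F)
    then have "abs1 (f x + sum f F) \<le> g x + sum g F"
      using abs1_triangle[of "f x" "sum f F"] le[of x] by simp
    then show ?case using insert by simp
  qed simp
  then show "\<forall>\<^sub>F F in finite_subsets_at_top A. abs1 (sum f F) \<le> sum g F"
    by (simp add: eventually_finite_subsets_at_top_weakI)
qed simp

lemma integral_cis_period:
  "integral {0..2 * pi} (\<lambda>x. cis (of_int n * x)) = (if n = 0 then of_real (2 * pi) else 0)"
proof (cases "n = 0")
  case True
  then show ?thesis by (simp add: scaleR_conv_of_real)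
next
  case False
  have "((\<lambda>x. cis (of_int n * x)) has_integral
      (cis (of_int n * (2 * pi)) / (\<i> * of_int n) - cis (of_int n * 0) / (\<i> * of_int n))) {0..2 * pi}"
  proof (rule fundamental_theorem_of_calculus)
    show "((\<lambda>x. cis (of_int n * x) / (\<i> * of_int n)) has_vector_derivative cis (of_int n * x))
        (at x within {0..2 * pi})" for x
      unfolding has_vector_derivative_def
      by (rule has_derivative_eq_rhs, (rule derivative_eq_intros refl)+)
        (use False in \<open>auto simp: fun_eq_iff scaleR_conv_of_real field_simps\<close>)
  qed simp
  moreover have "cis (of_int n * (2 * pi)) = 1"
    by (metis cis_multiple_2pi Ints_of_int mult.commute mult.left_commute)
  ultimately show ?thesis using False by (simp add: integral_unique)
qed

lemma integral_mode:
  "integral torus_cell (mode k) = (if k = 0 then of_real ((2 * pi)\<^sup>2) else 0)"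
proof -
  obtain k1 k2 where k: "k = (k1, k2)" by (cases k)
  have "integral torus_cell (mode k)
      = integral (cbox 0 (2 * pi)) (\<lambda>\<theta>. integral (cbox 0 (2 * pi)) (\<lambda>x. mode k (\<theta>, x)))"
    unfolding torus_cell_def by (rule integral_prod_continuous[OF continuous_on_mode])
  also have "\<dots> = integral {0..2 * pi} (\<lambda>\<theta>. cis (of_int k2 * \<theta>) *
      integral {0..2 * pi} (\<lambda>x. cis (of_int k1 * x)))"
    by (simp add: k mode_def cis_mult[symmetric] mult.commute)
  also have "\<dots> = (if k2 = 0 then of_real (2 * pi) else 0) * (if k1 = 0 then of_real (2 * pi) else 0)"
    by (simp only: integral_mult_left integral_cis_period)
  finally show ?thesis by (simp add: k zero_prod_def power2_eq_square)
qed

section \<open>Absolutely convergent Fourier series\<close>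

text \<open>This symmetry characterises the Fourier coefficients of real-valued functions, and the symbols
  of multipliers that preserve real-valuedness.\<close>

definition hermitian :: "coeffs \<Rightarrow> bool"
  where "hermitian a \<longleftrightarrow> (\<forall>k. a (- k) = cnj (a k))"

lemma hermitianD: "hermitian a \<Longrightarrow> a (- k) = cnj (a k)"
  unfolding hermitian_def by blast

lemma hermitian_mult: "hermitian m \<Longrightarrow> hermitian a \<Longrightarrow> hermitian (\<lambda>k. m k * a k)"
  by (simp add: hermitian_def)

lemma hermitian_fcoeff: "hermitian (fcoeff u)"
proof -
  have "fcoeff u (- k) = cnj (fcoeff u k)" for k
    unfolding fcoeff_def by (simp add: mode_minus integral_cnj)
  then show ?thesis by (simp add: hermitian_def)
qed

lemma has_sum_fourier:
  assumes "(\<lambda>k. cmod (a k)) summable_on UNIV"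
  shows "((\<lambda>k. a k * mode k p) has_sum (\<Sum>\<^sub>\<infinity>k. a k * mode k p)) UNIV"
proof -
  have "(\<lambda>k. a k * mode k p) summable_on UNIV"
    by (rule abs_summable_summable) (simp add: norm_mult assms)
  then show ?thesis by simp
qed

lemma has_sum_fourier_sum:
  assumes a: "(\<lambda>k. cmod (a k)) summable_on UNIV" and herm: "hermitian a"
  shows "((\<lambda>k. a k * mode k p) has_sum complex_of_real (fourier_sum a p)) UNIV"
proof -
  let ?s = "\<Sum>\<^sub>\<infinity>k. a k * mode k p"
  have s: "((\<lambda>k. a k * mode k p) has_sum ?s) UNIV" by (rule has_sum_fourier[OF a])
  then have "((\<lambda>k. cnj (a k * mode k p)) has_sum cnj ?s) UNIV"
    by (simp only: has_sum_cnj_iff)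
  also have "?this \<longleftrightarrow> ((\<lambda>k. a k * mode k p) has_sum cnj ?s) UNIV"
    by (rule has_sum_reindex_bij_witness[of _ uminus uminus])
      (use herm in \<open>auto simp: hermitian_def mode_minus\<close>)
  finally have "cnj ?s = ?s" using s has_sum_unique by blast
  then have "?s = complex_of_real (fourier_sum a p)"
    by (simp add: fourier_sum_def complex_eq_iff)
  then show ?thesis using s by simp
qed

text \<open>The series converges uniformly, so it may be integrated term by term against a mode, and
  only one term survives.  Consequently coefficients of sums, products and multiplier images can
  be read off from any absolutely convergent expansion, without further integration.\<close>

lemma fcoeff_unique:
  assumes a: "(\<lambda>k. cmod (a k)) summable_on UNIV"
    and u: "\<And>p. ((\<lambda>k. a k * mode k p) has_sum complex_of_real (u p)) UNIV"
  shows "fcoeff u = a"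
proof
  fix l
  let ?f = "\<lambda>F p. \<Sum>k\<in>F. a k * mode k p * cnj (mode l p)"
  have ul: "uniform_limit torus_cell ?f (\<lambda>p. complex_of_real (u p) * cnj (mode l p))
      (finite_subsets_at_top UNIV)"
    using a by (rule Weierstrass_m_test_general'[rotated 2])
      (auto simp: norm_mult intro!: has_sum_cmult_left u)
  have cont: "continuous_on torus_cell (?f F)" for F
    by (intro continuous_intros continuous_on_mode)
  obtain I J where
    I: "\<And>F. (?f F has_integral I F) torus_cell" and
    J: "((\<lambda>p. complex_of_real (u p) * cnj (mode l p)) has_integral J) torus_cell" and
    lim: "(I \<longlongrightarrow> J) (finite_subsets_at_top UNIV)"
    using uniform_limit_integral_cbox[OF ul[unfolded torus_cell_def] cont[unfolded torus_cell_def]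
        finite_subsets_at_top_neq_bot]
    unfolding torus_cell_def by blast
  have summand: "((\<lambda>p. a k * mode k p * cnj (mode l p)) has_integral
      (if k = l then a l * of_real ((2 * pi)\<^sup>2) else 0)) torus_cell" for k
  proof -
    have "(mode (k - l)) integrable_on torus_cell"
      unfolding torus_cell_def by (intro integrable_continuous continuous_on_mode)
    then have "(mode (k - l) has_integral (if k = l then of_real ((2 * pi)\<^sup>2) else 0)) torus_cell"
      using integral_mode[of "k - l"] by (auto simp: has_integral_iff)
    from has_integral_mult_right[OF this, of "a k"] show ?thesis
      using mode_plus[of k "- l"] by (cases "k = l") (simp_all add: mode_minus mult.assoc)
  qed
  have "I F = a l * of_real ((2 * pi)\<^sup>2)" if "finite F" "l \<in> F" for F
  proof -
    have "(?f F has_integral (\<Sum>k\<in>F. if k = l then a l * of_real ((2 * pi)\<^sup>2) else 0)) torus_cell"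
      using that(1) summand by (intro has_integral_sum)
    then show ?thesis
      using I[of F] that by (simp add: has_integral_unique sum.delta)
  qed
  then have "eventually (\<lambda>F. I F = a l * of_real ((2 * pi)\<^sup>2)) (finite_subsets_at_top UNIV)"
    unfolding eventually_finite_subsets_at_top by (intro exI[of _ "{l}"]) auto
  then have "(I \<longlongrightarrow> a l * of_real ((2 * pi)\<^sup>2)) (finite_subsets_at_top UNIV)"
    by (rule tendsto_eventually)
  then have "J = a l * of_real ((2 * pi)\<^sup>2)"
    using lim tendsto_unique[OF finite_subsets_at_top_neq_bot] by blast
  then show "fcoeff u l = a l"
    using J by (simp add: fcoeff_def integral_unique)
qed

section \<open>The weighted space as a Banach space\<close>

locale torus_weight =
  fixes r s1 s2 :: real
  assumes r: "0 \<le> r" and s1: "0 \<le> s1" and s2: "0 \<le> s2"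
begin

abbreviation "w \<equiv> weight r s1 s2"
abbreviation "X \<equiv> XM r s1 s2"
abbreviation "nrm \<equiv> normM r s1 s2"

lemma weight_ge_1: "1 \<le> w k"
proof -
  obtain k1 k2 where k: "k = (k1, k2)" by (cases k)
  have "1 \<le> (1 + \<bar>real_of_int k1\<bar>) powr s1" "1 \<le> (1 + \<bar>real_of_int k2\<bar>) powr s2"
    "1 \<le> exp (r * (\<bar>real_of_int k1\<bar> + \<bar>real_of_int k2\<bar>))"
    using r s1 s2 by (auto intro!: ge_one_powr_ge_zero)
  then have "1 * 1 * 1 \<le> w k"
    unfolding k weight_def prod.case by (intro mult_mono) auto
  then show ?thesis by simp
qed

lemma weight_pos: "0 < w k"
  using weight_ge_1[of k] by simp

text \<open>Submultiplicativity of the weight is what makes the space an algebra.\<close>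

lemma weight_plus_le: "w (k + l) \<le> w k * w l"
proof -
  obtain k1 k2 where k: "k = (k1, k2)" by (cases k)
  obtain l1 l2 where l: "l = (l1, l2)" by (cases l)
  have powr: "(1 + \<bar>real_of_int (i + j)\<bar>) powr s
      \<le> (1 + \<bar>real_of_int i\<bar>) powr s * (1 + \<bar>real_of_int j\<bar>) powr s" if "0 \<le> s" for i j s
  proof -
    have "1 + \<bar>real_of_int (i + j)\<bar> \<le> (1 + \<bar>real_of_int i\<bar>) * (1 + \<bar>real_of_int j\<bar>)"
      using abs_triangle_ineq[of "real_of_int i" "real_of_int j"]
        mult_nonneg_nonneg[OF abs_ge_zero[of "real_of_int i"] abs_ge_zero[of "real_of_int j"]]
      by (simp only: of_int_add ring_distribs mult_1_left mult_1_right)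
    then have "(1 + \<bar>real_of_int (i + j)\<bar>) powr s
        \<le> ((1 + \<bar>real_of_int i\<bar>) * (1 + \<bar>real_of_int j\<bar>)) powr s"
      using that by (intro powr_mono2) auto
    then show ?thesis by (simp add: powr_mult)
  qed
  have "\<bar>real_of_int (k1 + l1)\<bar> + \<bar>real_of_int (k2 + l2)\<bar>
      \<le> (\<bar>real_of_int k1\<bar> + \<bar>real_of_int k2\<bar>) + (\<bar>real_of_int l1\<bar> + \<bar>real_of_int l2\<bar>)"
    by simp
  from mult_left_mono[OF this r]
  have expo: "exp (r * (\<bar>real_of_int (k1 + l1)\<bar> + \<bar>real_of_int (k2 + l2)\<bar>))
      \<le> exp (r * (\<bar>real_of_int k1\<bar> + \<bar>real_of_int k2\<bar>)) * exp (r * (\<bar>real_of_int l1\<bar> + \<bar>real_of_int l2\<bar>))"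
    by (simp add: exp_add[symmetric] distrib_left)
  have "w (k + l) \<le>
      (((1 + \<bar>real_of_int k1\<bar>) powr s1 * (1 + \<bar>real_of_int l1\<bar>) powr s1) *
       ((1 + \<bar>real_of_int k2\<bar>) powr s2 * (1 + \<bar>real_of_int l2\<bar>) powr s2)) *
      (exp (r * (\<bar>real_of_int k1\<bar> + \<bar>real_of_int k2\<bar>)) * exp (r * (\<bar>real_of_int l1\<bar> + \<bar>real_of_int l2\<bar>)))"
    unfolding k l weight_def add_Pair prod.case
    by (intro mult_mono powr s1 s2 expo) auto
  also have "\<dots> = w k * w l" by (simp add: k l weight_def)
  finally show ?thesis .
qed

text \<open>The image of the function space under \<open>fcoeff\<close>, with inverse \<open>fourier_sum\<close>:
  membership of a function is proved by exhibiting its coefficients here.\<close>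

definition l1w :: "coeffs set"
  where "l1w = {a. hermitian a \<and> (\<lambda>k. w k * abs1 (a k)) summable_on UNIV}"

lemma l1w_summable:
  assumes "a \<in> l1w"
  shows "(\<lambda>k. w k * abs1 (a k)) summable_on UNIV" and "(\<lambda>k. cmod (a k)) summable_on UNIV"
proof -
  show 1: "(\<lambda>k. w k * abs1 (a k)) summable_on UNIV" using assms by (simp add: l1w_def)
  show "(\<lambda>k. cmod (a k)) summable_on UNIV"
  proof (rule summable_on_comparison_test[OF 1])
    show "cmod (a k) \<le> w k * abs1 (a k)" for k
      using cmod_le_abs1[of "a k"] mult_right_mono[OF weight_ge_1[of k] abs1_nonneg[of "a k"]] by simp
  qed simp
qed

lemma XM_I:
  assumes a: "a \<in> l1w" and u: "\<And>p. ((\<lambda>k. a k * mode k p) has_sum complex_of_real (u p)) UNIV"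
  shows "u \<in> X" and "fcoeff u = a"
proof -
  show 1: "fcoeff u = a" using fcoeff_unique[OF l1w_summable(2)[OF a] u] .
  show "u \<in> X" using u l1w_summable(1)[OF a] by (simp add: XM_def 1 del: split_paired_All)
qed

lemma XM_D:
  assumes "u \<in> X"
  shows "fcoeff u \<in> l1w"
    and "((\<lambda>k. fcoeff u k * mode k p) has_sum complex_of_real (u p)) UNIV"
  using assms hermitian_fcoeff by (simp_all add: XM_def l1w_def del: split_paired_All)

lemma fourier_sum_XM:
  assumes "a \<in> l1w"
  shows "fourier_sum a \<in> X" and "fcoeff (fourier_sum a) = a"
proof -
  have "hermitian a" using assms by (simp add: l1w_def)
  then have "((\<lambda>k. a k * mode k p) has_sum complex_of_real (fourier_sum a p)) UNIV" for p
    using has_sum_fourier_sum[OF l1w_summable(2)[OF assms]] by simp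
  from XM_I[OF assms this] show "fourier_sum a \<in> X" "fcoeff (fourier_sum a) = a" by simp_all
qed

lemma XM_eqI:
  assumes that: "u \<in> X" "v \<in> X" "fcoeff u = fcoeff v"
  shows "u = v"
proof
  fix p
  show "u p = v p"
    using has_sum_unique[OF XM_D(2)[OF that(1)] XM_D(2)[OF that(2), of p, folded that(3)]] by simp
qed

lemma has_sum_nrm: "u \<in> X \<Longrightarrow> ((\<lambda>k. w k * abs1 (fcoeff u k)) has_sum nrm u) UNIV"
  unfolding normM_def using l1w_summable(1)[OF XM_D(1)] by simp

lemma l1w_add: "a \<in> l1w \<Longrightarrow> b \<in> l1w \<Longrightarrow> (\<lambda>k. a k + b k) \<in> l1w"
proof -
  assume a: "a \<in> l1w" and b: "b \<in> l1w"
  have "(\<lambda>k. w k * abs1 (a k + b k)) summable_on UNIV"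
  proof (rule summable_on_comparison_test[OF summable_on_add[OF l1w_summable(1)[OF a] l1w_summable(1)[OF b]]])
    show "w k * abs1 (a k + b k) \<le> w k * abs1 (a k) + w k * abs1 (b k)" for k
      using mult_left_mono[OF abs1_triangle[of "a k" "b k"] less_imp_le[OF weight_pos[of k]]]
      by (simp add: distrib_left)
    show "0 \<le> w k * abs1 (a k + b k)" for k
      using weight_pos[of k] by (simp add: less_imp_le)
  qed
  then show ?thesis using a b by (simp add: l1w_def hermitian_def)
qed

text \<open>A Fourier multiplier with bounded symbol acts boundedly, because \<open>abs1\<close> is
  submultiplicative.\<close>

lemma l1w_mult:
  assumes a: "a \<in> l1w" and m: "hermitian m" and K: "\<And>k. abs1 (m k) \<le> K"
  shows "(\<lambda>k. m k * a k) \<in> l1w"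
    and "((\<lambda>k. w k * abs1 (m k * a k)) has_sum S) UNIV \<Longrightarrow>
      ((\<lambda>k. w k * abs1 (a k)) has_sum T) UNIV \<Longrightarrow> S \<le> K * T"
proof -
  have le: "w k * abs1 (m k * a k) \<le> K * (w k * abs1 (a k))" for k
  proof -
    have "abs1 (m k * a k) \<le> K * abs1 (a k)"
      using abs1_mult_le[of "m k" "a k"] mult_right_mono[OF K[of k] abs1_nonneg[of "a k"]] by simp
    from mult_left_mono[OF this less_imp_le[OF weight_pos[of k]]] show ?thesis
      by (simp add: mult.left_commute)
  qed
  have "(\<lambda>k. w k * abs1 (m k * a k)) summable_on UNIV"
  proof (rule summable_on_comparison_test[OF summable_on_cmult_right[OF l1w_summable(1)[OF a], of K]])
    show "w k * abs1 (m k * a k) \<le> K * (w k * abs1 (a k))" for k by (rule le)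
    show "0 \<le> w k * abs1 (m k * a k)" for k
      using weight_pos[of k] by (simp add: less_imp_le)
  qed
  then show "(\<lambda>k. m k * a k) \<in> l1w"
    using a m hermitian_mult by (simp add: l1w_def)
  show "S \<le> K * T" if "((\<lambda>k. w k * abs1 (m k * a k)) has_sum S) UNIV"
    "((\<lambda>k. w k * abs1 (a k)) has_sum T) UNIV"
    using has_sum_mono[OF that(1) has_sum_cmult_right[OF that(2), of K] le] .
qed

lemma XM_add:
  assumes u: "u \<in> X" and v: "v \<in> X"
  shows "u + v \<in> X" and "fcoeff (u + v) = (\<lambda>k. fcoeff u k + fcoeff v k)"
proof -
  have "((\<lambda>k. (fcoeff u k + fcoeff v k) * mode k p) has_sum complex_of_real ((u + v) p)) UNIV" for p
    using has_sum_add[OF XM_D(2)[OF u] XM_D(2)[OF v], of p] by (simp add: distrib_right)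
  from XM_I[where u = "u + v", OF l1w_add[OF XM_D(1)[OF u] XM_D(1)[OF v]] this]
  show "u + v \<in> X" "fcoeff (u + v) = (\<lambda>k. fcoeff u k + fcoeff v k)" by simp_all
qed

lemma XM_scaleR:
  assumes u: "u \<in> X"
  shows "c *\<^sub>R u \<in> X" and "fcoeff (c *\<^sub>R u) = (\<lambda>k. c *\<^sub>R fcoeff u k)"
proof -
  have "((\<lambda>k. (of_real c * fcoeff u k) * mode k p) has_sum complex_of_real ((c *\<^sub>R u) p)) UNIV" for p
    using has_sum_cmult_right[OF XM_D(2)[OF u], of "of_real c" p]
    by (simp add: scaleR_fun_def mult.assoc)
  moreover have "(\<lambda>k. of_real c * fcoeff u k) \<in> l1w"
    by (rule l1w_mult(1)[OF XM_D(1)[OF u], of "\<lambda>_. of_real c" "\<bar>c\<bar>"])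
      (simp_all add: hermitian_def abs1_def)
  ultimately show "c *\<^sub>R u \<in> X" "fcoeff (c *\<^sub>R u) = (\<lambda>k. c *\<^sub>R fcoeff u k)"
    using XM_I[of "\<lambda>k. of_real c * fcoeff u k" "c *\<^sub>R u"] by (simp_all add: scaleR_conv_of_real)
qed

lemma XM_zero: "0 \<in> X" and fcoeff_zero: "fcoeff 0 = (\<lambda>k. 0)"
proof -
  have "(\<lambda>k. 0) \<in> l1w" by (simp add: l1w_def hermitian_def)
  from XM_I[OF this, of 0] show "0 \<in> X" "fcoeff 0 = (\<lambda>k. 0)" by simp_all
qed

lemma subspace_XM: "subspace X"
  unfolding subspace_def using XM_zero XM_add(1) XM_scaleR(1) by blast

lemma XM_diff:
  assumes u: "u \<in> X" and v: "v \<in> X"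
  shows "u - v \<in> X" and "fcoeff (u - v) = (\<lambda>k. fcoeff u k - fcoeff v k)"
proof -
  show "u - v \<in> X" using subspace_diff[OF subspace_XM u v] .
  have "u - v = u + (-1) *\<^sub>R v" by simp
  then show "fcoeff (u - v) = (\<lambda>k. fcoeff u k - fcoeff v k)"
    using XM_add(2)[OF u XM_scaleR(1)[OF v, of "-1"]] XM_scaleR(2)[OF v, of "-1"] by simp
qed

lemma abs_le_nrm:
  assumes u: "u \<in> X" shows "\<bar>u p\<bar> \<le> nrm u"
proof -
  have "cmod (complex_of_real (u p)) \<le> nrm u"
  proof (rule norm_infsum_le[OF XM_D(2)[OF u] has_sum_nrm[OF u]])
    show "cmod (fcoeff u k * mode k p) \<le> w k * abs1 (fcoeff u k)" for k
      using cmod_le_abs1[of "fcoeff u k"] mult_right_mono[OF weight_ge_1[of k] abs1_nonneg[of "fcoeff u k"]]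
      by (simp add: norm_mult)
  qed
  then show ?thesis by simp
qed

lemma coeff_le_nrm:
  assumes u: "u \<in> X" and F: "finite F"
  shows "sum (\<lambda>k. w k * abs1 (fcoeff u k)) F \<le> nrm u"
  by (rule finite_sum_le_has_sum[OF has_sum_nrm[OF u] F])
    (simp_all add: less_imp_le[OF weight_pos])

text \<open>Completeness is that of a weighted \<open>\<ell>\<^sup>1\<close> space: coefficients converge one by one, and the
  Cauchy estimate passes to the limit on every finite set of indices.\<close>

lemma XM_complete:
  assumes U: "\<And>n. U n \<in> X"
    and cauchy: "\<And>\<epsilon>. \<epsilon> > 0 \<Longrightarrow> \<exists>M. \<forall>m\<ge>M. \<forall>n\<ge>M. nrm (U m - U n) < \<epsilon>"
  shows "\<exists>l\<in>X. (\<lambda>n. nrm (U n - l)) \<longlonglongrightarrow> 0"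
proof -
  let ?a = "\<lambda>n. fcoeff (U n)"
  have diff_le: "sum (\<lambda>k. w k * abs1 (?a m k - ?a n k)) F \<le> nrm (U m - U n)" if "finite F" for m n F
    using coeff_le_nrm[OF XM_diff(1)[OF U[of m] U[of n]] that] XM_diff(2)[OF U[of m] U[of n]] by simp
  have "\<exists>z. (\<lambda>n. ?a n k) \<longlonglongrightarrow> z" for k
  proof -
    have "Cauchy (\<lambda>n. ?a n k)"
    proof (rule metric_CauchyI)
      fix \<epsilon> :: real assume "\<epsilon> > 0"
      then obtain M where M: "\<And>m n. m \<ge> M \<Longrightarrow> n \<ge> M \<Longrightarrow> nrm (U m - U n) < \<epsilon>" using cauchy by blast
      have "dist (?a m k) (?a n k) < \<epsilon>" if "m \<ge> M" "n \<ge> M" for m n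
      proof -
        have "cmod (?a m k - ?a n k) \<le> w k * abs1 (?a m k - ?a n k)"
          using cmod_le_abs1[of "?a m k - ?a n k"]
            mult_right_mono[OF weight_ge_1[of k] abs1_nonneg[of "?a m k - ?a n k"]] by simp
        also have "\<dots> \<le> nrm (U m - U n)" using diff_le[of "{k}" m n] by simp
        finally show ?thesis using M[OF that] by (simp add: dist_norm)
      qed
      then show "\<exists>M. \<forall>m\<ge>M. \<forall>n\<ge>M. dist (?a m k) (?a n k) < \<epsilon>" by blast
    qed
    then show ?thesis using Cauchy_convergent_iff convergent_def by blast
  qed
  then obtain b where b: "\<And>k. (\<lambda>n. ?a n k) \<longlonglongrightarrow> b k" by metis
  have herm: "hermitian b"
    unfolding hermitian_def
  proof
    fix k
    have "(\<lambda>n. ?a n (- k)) \<longlonglongrightarrow> cnj (b k)"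
      using tendsto_cnj[OF b[of k]] by (simp only: hermitianD[OF hermitian_fcoeff])
    then show "b (- k) = cnj (b k)" using b[of "- k"] LIMSEQ_unique by blast
  qed
  have tail: "\<exists>M. \<forall>m\<ge>M. (\<lambda>k. ?a m k - b k) \<in> l1w \<and> (\<Sum>\<^sub>\<infinity>k. w k * abs1 (?a m k - b k)) \<le> \<epsilon>"
    if "\<epsilon> > 0" for \<epsilon>
  proof -
    obtain M where M: "\<And>m n. m \<ge> M \<Longrightarrow> n \<ge> M \<Longrightarrow> nrm (U m - U n) < \<epsilon>"
      using cauchy[OF \<open>\<epsilon> > 0\<close>] by blast
    have "(\<lambda>k. ?a m k - b k) \<in> l1w \<and> (\<Sum>\<^sub>\<infinity>k. w k * abs1 (?a m k - b k)) \<le> \<epsilon>" if m: "m \<ge> M" for m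
    proof -
      have fin: "sum (\<lambda>k. w k * abs1 (?a m k - b k)) F \<le> \<epsilon>" if F: "finite F" for F
      proof (rule LIMSEQ_le_const2)
        show "(\<lambda>n. sum (\<lambda>k. w k * abs1 (?a m k - ?a n k)) F) \<longlonglongrightarrow> sum (\<lambda>k. w k * abs1 (?a m k - b k)) F"
          by (intro tendsto_sum tendsto_mult tendsto_const tendsto_abs1 tendsto_diff b)
        show "\<exists>N. \<forall>n\<ge>N. sum (\<lambda>k. w k * abs1 (?a m k - ?a n k)) F \<le> \<epsilon>"
        proof (intro exI[of _ M] allI impI)
          fix n assume "M \<le> n"
          then show "sum (\<lambda>k. w k * abs1 (?a m k - ?a n k)) F \<le> \<epsilon>"
            using diff_le[OF F, of m n] M[OF m] by (meson less_imp_le order_trans)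
        qed
      qed
      have sm: "(\<lambda>k. w k * abs1 (?a m k - b k)) summable_on UNIV"
        by (rule nonneg_bdd_above_summable_on)
          (auto intro!: bdd_aboveI[of _ \<epsilon>] fin mult_nonneg_nonneg less_imp_le[OF weight_pos])
      then have "(\<Sum>\<^sub>\<infinity>k. w k * abs1 (?a m k - b k)) \<le> \<epsilon>"
        using fin by (intro infsum_le_finite_sums) auto
      moreover have "hermitian (\<lambda>k. ?a m k - b k)"
        using herm hermitian_fcoeff[of "U m"] by (simp add: hermitian_def)
      ultimately show ?thesis using sm by (simp add: l1w_def)
    qed
    then show ?thesis by blast
  qed
  obtain m where m: "(\<lambda>k. ?a m k - b k) \<in> l1w" using tail[of 1] by auto
  have "(\<lambda>k. (-1) * (?a m k - b k)) \<in> l1w"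
    by (rule l1w_mult(1)[OF m, of "\<lambda>_. -1" 1]) (simp_all add: hermitian_def abs1_def)
  from l1w_add[OF XM_D(1)[OF U[of m]] this] have bl: "b \<in> l1w" by simp
  let ?l = "fourier_sum b"
  have l: "?l \<in> X" "fcoeff ?l = b" using fourier_sum_XM[OF bl] by simp_all
  have "(\<lambda>n. nrm (U n - ?l)) \<longlonglongrightarrow> 0"
  proof (rule LIMSEQ_I)
    fix \<epsilon> :: real assume "\<epsilon> > 0"
    then obtain M where M: "\<And>m. m \<ge> M \<Longrightarrow> (\<Sum>\<^sub>\<infinity>k. w k * abs1 (?a m k - b k)) \<le> \<epsilon> / 2"
      using tail[of "\<epsilon> / 2"] by auto
    have "norm (nrm (U n - ?l) - 0) < \<epsilon>" if "n \<ge> M" for n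
    proof -
      have "nrm (U n - ?l) \<le> \<epsilon> / 2"
        using M[OF that] XM_diff(2)[OF U[of n] l(1)] l(2) by (simp add: normM_def)
      moreover have "0 \<le> nrm (U n - ?l)"
        unfolding normM_def by (intro infsum_nonneg) (simp add: less_imp_le[OF weight_pos])
      ultimately show ?thesis using \<open>\<epsilon> > 0\<close> by simp
    qed
    then show "\<exists>N. \<forall>n\<ge>N. norm (nrm (U n - ?l) - 0) < \<epsilon>" by blast
  qed
  then show ?thesis using l(1) by blast
qed

lemma banach_XM: "banach_subspace X nrm"
proof
  show "subspace X" by (rule subspace_XM)
  show "nrm (u + v) \<le> nrm u + nrm v" if u: "u \<in> X" and v: "v \<in> X" for u v
  proof (rule has_sum_mono[OF has_sum_nrm[OF XM_add(1)[OF u v]]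
        has_sum_add[OF has_sum_nrm[OF u] has_sum_nrm[OF v]]])
    show "w k * abs1 (fcoeff (u + v) k) \<le> w k * abs1 (fcoeff u k) + w k * abs1 (fcoeff v k)" for k
      using mult_left_mono[OF abs1_triangle less_imp_le[OF weight_pos[of k]]]
      by (simp add: XM_add(2)[OF u v] distrib_left[symmetric])
  qed
  show "nrm (c *\<^sub>R u) = \<bar>c\<bar> * nrm u" if u: "u \<in> X" for c u
    unfolding normM_def XM_scaleR(2)[OF u] abs1_scaleR mult.left_commute[of _ "\<bar>c\<bar>"]
    by (rule infsum_cmult_right')
  show "u = 0" if u: "u \<in> X" and 0: "nrm u = 0" for u
  proof (rule XM_eqI[OF u XM_zero], unfold fcoeff_zero, rule ext)
    fix k
    have "w k * abs1 (fcoeff u k) \<le> 0" using coeff_le_nrm[OF u, of "{k}"] 0 by simp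
    moreover have "abs1 (fcoeff u k) \<le> w k * abs1 (fcoeff u k)"
      using mult_right_mono[OF weight_ge_1[of k] abs1_nonneg[of "fcoeff u k"]] by simp
    ultimately have "abs1 (fcoeff u k) = 0" using abs1_nonneg[of "fcoeff u k"] by linarith
    then show "fcoeff u k = 0" by simp
  qed
  show "\<exists>l\<in>X. (\<lambda>n. nrm (U n - l)) \<longlonglongrightarrow> 0"
    if "\<And>n. U n \<in> X" "\<And>\<epsilon>. \<epsilon> > 0 \<Longrightarrow> \<exists>M. \<forall>m\<ge>M. \<forall>n\<ge>M. nrm (U m - U n) < \<epsilon>" for U
    by (rule XM_complete[OF that])
qed

section \<open>Products\<close>

text \<open>The double series of all products \<open>a k * b l\<close>, weighted, converges absolutely to the product of
  the norms.  Summing it along the lines \<open>k + l = m\<close> gives both the norm bound for the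
  convolution \<open>c\<close> and the fact that \<open>c\<close> is the coefficient family of the pointwise product.\<close>

lemma XM_mult:
  assumes u: "u \<in> X" and v: "v \<in> X"
  shows "u * v \<in> X" and "nrm (u * v) \<le> nrm u * nrm v"
proof -
  let ?a = "fcoeff u" and ?b = "fcoeff v"
  let ?A = "\<lambda>k. w k * abs1 (?a k)" and ?B = "\<lambda>k. w k * abs1 (?b k)"
  let ?f = "\<lambda>(k, l). ?A k * ?B l"
  \<comment> \<open>\<open>?r\<close> lists the index pairs \<open>(k, l)\<close> by their sum \<open>m\<close>.\<close>
  let ?r = "\<lambda>(m :: int \<times> int, k). (k, m - k)"
  have A0: "0 \<le> ?A k" and B0: "0 \<le> ?B k" for k
    using weight_pos[of k] by simp_all
  have fib: "((\<lambda>l. ?f (k, l)) has_sum (?A k * nrm v)) UNIV" for k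
    using has_sum_cmult_right[OF has_sum_nrm[OF v], of "?A k"] by simp
  have base: "((\<lambda>k. ?A k * nrm v) has_sum (nrm u * nrm v)) UNIV"
    by (rule has_sum_cmult_left[OF has_sum_nrm[OF u]])
  have f_sm: "?f summable_on UNIV \<times> UNIV"
    by (rule summable_on_SigmaI[OF fib has_sum_imp_summable[OF base]]) (use A0 B0 in auto)
  have f_sum: "(?f has_sum (nrm u * nrm v)) (UNIV \<times> UNIV)"
    by (rule has_sum_SigmaI[OF fib base f_sm])
  have bij: "bij_betw ?r (UNIV \<times> UNIV) (UNIV \<times> UNIV)"
    by (rule bij_betwI[where g = "\<lambda>(k :: int \<times> int, l). (k + l, k)"]) auto
  have F_sum: "((\<lambda>x. ?f (?r x)) has_sum (nrm u * nrm v)) (UNIV \<times> UNIV)"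
    using f_sum has_sum_reindex_bij_betw[OF bij, of ?f] by blast
  define D where "D m = (\<Sum>\<^sub>\<infinity>k. ?A k * ?B (m - k))" for m
  define c where "c m = (\<Sum>\<^sub>\<infinity>k. ?a k * ?b (m - k))" for m
  have F_fib: "((\<lambda>k. ?A k * ?B (m - k)) has_sum D m) UNIV" for m
  proof -
    have "(\<lambda>(m, k). ?A k * ?B (m - k)) summable_on (SIGMA m:UNIV. UNIV)"
      using has_sum_imp_summable[OF F_sum] by (simp add: case_prod_unfold)
    from summable_on_SigmaD1[OF this, of m] show ?thesis
      using A0 B0 by (simp add: D_def)
  qed
  have D_sum: "(D has_sum (nrm u * nrm v)) UNIV"
    by (rule has_sum_SigmaD[OF F_sum]) (use F_fib in simp)
  have conv_le: "abs1 (?a k * ?b (m - k)) \<le> ?A k * ?B (m - k)" for k m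
  proof -
    have "abs1 (?a k * ?b (m - k)) \<le> abs1 (?a k) * abs1 (?b (m - k))" by (rule abs1_mult_le)
    also have "\<dots> \<le> ?A k * ?B (m - k)"
      using mult_right_mono[OF weight_ge_1[of k] abs1_nonneg[of "?a k"]]
        mult_right_mono[OF weight_ge_1[of "m - k"] abs1_nonneg[of "?b (m - k)"]]
      by (intro mult_mono) (simp_all add: less_imp_le[OF weight_pos])
    finally show ?thesis .
  qed
  have c_fib: "((\<lambda>k. ?a k * ?b (m - k)) has_sum c m) UNIV" for m
  proof -
    have "(\<lambda>k. cmod (?a k * ?b (m - k))) summable_on UNIV"
    proof (rule summable_on_comparison_test[OF has_sum_imp_summable[OF F_fib[of m]]])
      show "cmod (?a k * ?b (m - k)) \<le> ?A k * ?B (m - k)" for k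
        using order_trans[OF cmod_le_abs1 conv_le[of k m]] .
    qed simp
    then show ?thesis unfolding c_def by (rule has_sum_infsum[OF abs_summable_summable])
  qed
  have c_le: "w m * abs1 (c m) \<le> D m" for m
  proof -
    have "((\<lambda>k. w m *\<^sub>R (?a k * ?b (m - k))) has_sum (w m *\<^sub>R c m)) UNIV"
      using c_fib by (rule has_sum_scaleR)
    then have "abs1 (w m *\<^sub>R c m) \<le> D m"
    proof (rule abs1_has_sum_le[OF _ F_fib[of m]])
      fix k
      have "w m \<le> w k * w (m - k)" using weight_plus_le[of k "m - k"] by simp
      then have "w m * abs1 (?a k * ?b (m - k)) \<le> (w k * w (m - k)) * (abs1 (?a k) * abs1 (?b (m - k)))"
        using abs1_mult_le weight_pos[of k] weight_pos[of "m - k"] by (intro mult_mono) auto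
      then show "abs1 (w m *\<^sub>R (?a k * ?b (m - k))) \<le> ?A k * ?B (m - k)"
        using weight_pos[of m] by (simp add: mult_ac)
    qed
    then show ?thesis using weight_pos[of m] by simp
  qed
  have herm: "hermitian c"
    unfolding hermitian_def
  proof
    fix m
    have "((\<lambda>k. cnj (?a k * ?b (m - k))) has_sum cnj (c m)) UNIV"
      using c_fib[of m] by (simp only: has_sum_cnj_iff)
    also have "?this \<longleftrightarrow> ((\<lambda>k. ?a k * ?b (- m - k)) has_sum cnj (c m)) UNIV"
    proof (rule has_sum_reindex_bij_witness[of _ uminus uminus])
      show "?a (- k) * ?b (- m - - k) = cnj (?a k * ?b (m - k))" for k
        using hermitianD[OF hermitian_fcoeff, of u k] hermitianD[OF hermitian_fcoeff, of v "m - k"]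
        by simp
    qed simp_all
    finally show "c (- m) = cnj (c m)"
      using c_fib[of "- m"] has_sum_unique by blast
  qed
  have "(\<lambda>m. w m * abs1 (c m)) summable_on UNIV"
    by (rule summable_on_comparison_test[OF has_sum_imp_summable[OF D_sum] c_le])
      (simp add: less_imp_le[OF weight_pos])
  then have cl: "c \<in> l1w" using herm by (simp add: l1w_def)
  have prod: "((\<lambda>m. c m * mode m p) has_sum complex_of_real ((u * v) p)) UNIV" for p
  proof -
    let ?g = "\<lambda>(k, l). (?a k * mode k p) * (?b l * mode l p)"
    have gfib: "((\<lambda>l. ?g (k, l)) has_sum ((?a k * mode k p) * of_real (v p))) UNIV" for k
      using has_sum_cmult_right[OF XM_D(2)[OF v], of "?a k * mode k p" p] by simp
    have gbase: "((\<lambda>k. (?a k * mode k p) * of_real (v p)) has_sum (of_real (u p) * of_real (v p))) UNIV"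
      by (rule has_sum_cmult_left[OF XM_D(2)[OF u]])
    have "(\<lambda>x. cmod (?g x)) summable_on UNIV \<times> UNIV"
    proof (rule summable_on_comparison_test[OF f_sm])
      show "cmod (?g x) \<le> ?f x" for x
      proof -
        obtain k l where x: "x = (k, l)" by (cases x)
        have "cmod (?a k) * cmod (?b l) \<le> ?A k * ?B l"
        proof (rule mult_mono)
          show "cmod (?a k) \<le> ?A k"
            using cmod_le_abs1[of "?a k"] mult_right_mono[OF weight_ge_1[of k] abs1_nonneg[of "?a k"]] by simp
          show "cmod (?b l) \<le> ?B l"
            using cmod_le_abs1[of "?b l"] mult_right_mono[OF weight_ge_1[of l] abs1_nonneg[of "?b l"]] by simp
        qed (use A0 in auto)
        then show ?thesis by (simp add: x norm_mult)
      qed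
    qed simp
    then have gsm: "?g summable_on UNIV \<times> UNIV" by (rule abs_summable_summable)
    have "(?g has_sum (of_real (u p) * of_real (v p))) (UNIV \<times> UNIV)"
      by (rule has_sum_SigmaI[OF gfib gbase gsm])
    then have G_sum: "((\<lambda>x. ?g (?r x)) has_sum (of_real (u p) * of_real (v p))) (UNIV \<times> UNIV)"
      using has_sum_reindex_bij_betw[OF bij, of ?g] by blast
    have "((\<lambda>m. c m * mode m p) has_sum (of_real (u p) * of_real (v p))) UNIV"
    proof (rule has_sum_SigmaD[OF G_sum])
      fix m
      have "?g (?r (m, k)) = ?a k * ?b (m - k) * mode m p" for k
        using mode_plus[of k "m - k" p] by simp
      then show "((\<lambda>k. ?g (?r (m, k))) has_sum (c m * mode m p)) UNIV"
        using has_sum_cmult_left[OF c_fib[of m], of "mode m p"] by presburger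
    qed
    then show ?thesis by simp
  qed
  note uv = XM_I[where u = "u * v", OF cl prod]
  show "u * v \<in> X" by (rule uv(1))
  show "nrm (u * v) \<le> nrm u * nrm v"
    using has_sum_mono[OF has_sum_nrm[OF uv(1)] D_sum] c_le uv(2) by simp
qed

section \<open>Fourier multipliers and parity\<close>

definition multiplier :: "coeffs \<Rightarrow> tfun \<Rightarrow> tfun"
  where "multiplier m v = fourier_sum (\<lambda>k. m k * fcoeff v k)"

lemma multiplier:
  assumes m: "hermitian m" and K: "\<And>k. abs1 (m k) \<le> K" and v: "v \<in> X"
  shows "multiplier m v \<in> X" and "fcoeff (multiplier m v) = (\<lambda>k. m k * fcoeff v k)"
    and "nrm (multiplier m v) \<le> K * nrm v"
proof -
  note l = l1w_mult[OF XM_D(1)[OF v] m K]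
  note fs = fourier_sum_XM[OF l(1)]
  show 1: "multiplier m v \<in> X" and 2: "fcoeff (multiplier m v) = (\<lambda>k. m k * fcoeff v k)"
    using fs by (simp_all add: multiplier_def)
  show "nrm (multiplier m v) \<le> K * nrm v"
    by (rule l(2)[OF has_sum_nrm[OF 1, unfolded 2] has_sum_nrm[OF v]])
qed

lemma multiplier_add:
  assumes m: "hermitian m" "\<And>k. abs1 (m k) \<le> K" and v: "v \<in> X" and v': "v' \<in> X"
  shows "multiplier m (v + v') = multiplier m v + multiplier m v'"
proof (rule XM_eqI)
  note mv = multiplier[OF m v] and mv' = multiplier[OF m v']
  note s = XM_add[OF v v']
  note ms = multiplier[OF m s(1)]
  show "multiplier m (v + v') \<in> X" by (rule ms(1))
  show "multiplier m v + multiplier m v' \<in> X" by (rule XM_add(1)[OF mv(1) mv'(1)])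
  show "fcoeff (multiplier m (v + v')) = fcoeff (multiplier m v + multiplier m v')"
    unfolding ms(2) XM_add(2)[OF mv(1) mv'(1)] mv(2) mv'(2) s(2) by (simp add: distrib_left)
qed

lemma multiplier_scaleR:
  assumes m: "hermitian m" "\<And>k. abs1 (m k) \<le> K" and v: "v \<in> X"
  shows "multiplier m (c *\<^sub>R v) = c *\<^sub>R multiplier m v"
proof (rule XM_eqI)
  note mv = multiplier[OF m v]
  note s = XM_scaleR[OF v, of c]
  note ms = multiplier[OF m s(1)]
  show "multiplier m (c *\<^sub>R v) \<in> X" by (rule ms(1))
  show "c *\<^sub>R multiplier m v \<in> X" by (rule XM_scaleR(1)[OF mv(1)])
  show "fcoeff (multiplier m (c *\<^sub>R v)) = fcoeff (c *\<^sub>R multiplier m v)"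
    unfolding ms(2) XM_scaleR(2)[OF mv(1)] mv(2) s(2) by simp
qed

lemma bounded_linear_multiplier:
  assumes m: "hermitian m" "\<And>k. abs1 (m k) \<le> K"
  shows "bounded_linear_op X nrm (multiplier m)"
  unfolding bounded_linear_op_def
  using multiplier(1,3)[OF m] multiplier_add[OF m] multiplier_scaleR[OF m] by blast

definition has_parity :: "real \<Rightarrow> tfun \<Rightarrow> bool"
  where "has_parity s v \<longleftrightarrow> (\<forall>\<theta> x. v (\<theta>, - x) = s * v (\<theta>, x))"

text \<open>Reflecting \<open>x\<close> permutes the terms of the Fourier series, so parity passes between a function
  and its coefficients by uniqueness of the expansion.\<close>

lemma has_parity_iff_fcoeff:
  assumes v: "v \<in> X"
  shows "has_parity s v \<longleftrightarrow> (\<forall>k1 k2. fcoeff v (- k1, k2) = of_real s * fcoeff v (k1, k2))"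
proof -
  let ?a = "fcoeff v" and ?v' = "\<lambda>(\<theta>, x). v (\<theta>, - x)"
  let ?a' = "\<lambda>(k1, k2). fcoeff v (- k1, k2)"
  have flip: "((\<lambda>k. ?a' k * mode k p) has_sum complex_of_real (?v' p)) UNIV" for p
  proof -
    obtain \<theta> x where p: "p = (\<theta>, x)" by (cases p)
    have "((\<lambda>k. ?a k * mode k (\<theta>, - x)) has_sum complex_of_real (?v' p)) UNIV"
      using XM_D(2)[OF v, of "(\<theta>, - x)"] by (simp add: p)
    also have "?this \<longleftrightarrow> ?thesis"
      by (rule has_sum_reindex_bij_witness[of _ "\<lambda>(k1, k2). (- k1, k2)" "\<lambda>(k1, k2). (- k1, k2)"])
        (auto simp: p mode_def)
    finally show ?thesis .
  qed
  have sc: "((\<lambda>k. (of_real s * ?a k) * mode k p) has_sum complex_of_real (s * v p)) UNIV" for p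
    using has_sum_cmult_right[OF XM_D(2)[OF v], of "of_real s" p] by (simp add: mult.assoc)
  have sm: "(\<lambda>k. cmod (of_real s * ?a k)) summable_on UNIV"
    using summable_on_cmult_right[OF l1w_summable(2)[OF XM_D(1)[OF v]], of "\<bar>s\<bar>"] by (simp add: norm_mult)
  have sm': "(\<lambda>k. cmod (?a' k)) summable_on UNIV"
    using l1w_summable(2)[OF XM_D(1)[OF v]]
    by (subst summable_on_reindex_bij_witness[of UNIV "\<lambda>(k1, k2). (- k1, k2)" "\<lambda>(k1, k2). (- k1, k2)" UNIV
          "\<lambda>k. cmod (?a k)"]) auto
  have par: "has_parity s v \<longleftrightarrow> ?v' = (\<lambda>p. s * v p)"
    by (auto simp: has_parity_def fun_eq_iff)
  have coef: "(\<forall>k1 k2. ?a (- k1, k2) = of_real s * ?a (k1, k2)) \<longleftrightarrow> ?a' = (\<lambda>k. of_real s * ?a k)"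
    by (auto simp: fun_eq_iff)
  show ?thesis
    unfolding par coef
  proof
    assume "?v' = (\<lambda>p. s * v p)"
    then show "?a' = (\<lambda>k. of_real s * ?a k)"
      using fcoeff_unique[OF sm' flip] fcoeff_unique[OF sm sc] by simp
  next
    assume eq: "?a' = (\<lambda>k. of_real s * ?a k)"
    show "?v' = (\<lambda>p. s * v p)"
    proof
      fix p
      have "complex_of_real (?v' p) = complex_of_real (s * v p)"
        using has_sum_unique[OF flip[of p, unfolded eq] sc[of p]] .
      then show "?v' p = s * v p" by (simp only: of_real_eq_iff)
    qed
  qed
qed

lemma multiplier_parity:
  assumes m: "hermitian m" "\<And>k. abs1 (m k) \<le> K" and v: "v \<in> X" and par: "has_parity s v"
    and flip: "\<And>k1 k2. m (- k1, k2) = of_real t * m (k1, k2)"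
  shows "has_parity (t * s) (multiplier m v)"
  using par has_parity_iff_fcoeff[OF v, of s] has_parity_iff_fcoeff[OF multiplier(1)[OF m v], of "t * s"]
  by (simp add: multiplier(2)[OF m v] flip)

abbreviation "Xodd \<equiv> XM_odd r s1 s2"

lemma XM_odd_iff: "u \<in> Xodd \<longleftrightarrow> u \<in> X \<and> has_parity (-1) u"
  by (simp add: XM_odd_def has_parity_def)

text \<open>The norm dominates point values, so oddness survives limits.\<close>

lemma banach_XM_odd: "banach_subspace Xodd nrm"
proof -
  interpret XM: banach_subspace X nrm by (rule banach_XM)
  have sub: "u \<in> X" if "u \<in> Xodd" for u using that by (simp add: XM_odd_iff)
  show ?thesis
  proof
    show "subspace Xodd"
      using XM_zero XM_add(1) XM_scaleR(1)
      by (auto simp: subspace_def XM_odd_def scaleR_fun_def)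
    fix U :: "nat \<Rightarrow> tfun" assume U: "\<And>n. U n \<in> Xodd"
      and cauchy: "\<And>\<epsilon>. \<epsilon> > 0 \<Longrightarrow> \<exists>M. \<forall>m\<ge>M. \<forall>n\<ge>M. nrm (U m - U n) < \<epsilon>"
    obtain l where l: "l \<in> X" "(\<lambda>n. nrm (U n - l)) \<longlonglongrightarrow> 0"
      using XM_complete[OF sub[OF U] cauchy] by blast
    have pt: "(\<lambda>n. U n p) \<longlonglongrightarrow> l p" for p
    proof (rule Lim_transform)
      show "(\<lambda>n. U n p - l p) \<longlonglongrightarrow> 0"
      proof (rule Lim_null_comparison[OF always_eventually[OF allI] l(2)])
        show "norm (U n p - l p) \<le> nrm (U n - l)" for n
          using abs_le_nrm[OF XM_diff(1)[OF sub[OF U[of n]] l(1)], of p] by simp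
      qed
    qed simp
    have "l (\<theta>, - x) = - l (\<theta>, x)" for \<theta> x
    proof -
      have "(\<lambda>n. U n (\<theta>, - x)) \<longlonglongrightarrow> - l (\<theta>, x)"
        using tendsto_minus[OF pt[of "(\<theta>, x)"]] U by (simp add: XM_odd_def)
      then show ?thesis using pt[of "(\<theta>, - x)"] LIMSEQ_unique by blast
    qed
    then show "\<exists>l\<in>Xodd. (\<lambda>n. nrm (U n - l)) \<longlonglongrightarrow> 0"
      using l by (auto simp: XM_odd_def)
  qed (use sub XM.norm_triangle XM.norm_scale XM.definite in auto)
qed

end

section \<open>The symbol\<close>

locale ks_operator = torus_weight +
  fixes \<nu> f c :: real
  assumes \<nu>: "0 < \<nu>" and f: "0 < f" and inv: "S_invertible \<nu> f c"
begin

abbreviation "S \<equiv> S_symbol \<nu> f c"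

definition inv_sym :: coeffs where "inv_sym k = 1 / S k"
definition dx_sym :: coeffs where "dx_sym = (\<lambda>(k1, k2). \<i> * of_int k1 / S (k1, k2))"
definition dt_sym :: coeffs where "dt_sym = (\<lambda>(k1, k2). \<i> * of_int k2 / S (k1, k2))"

lemma S_nonzero: "S k \<noteq> 0"
  using inv unfolding S_invertible_def by blast

lemma S_minus: "S (- k) = cnj (S k)"
  by (cases k) (simp add: S_symbol_def)

lemma S_flip: "S (- k1, k2) = S (k1, k2)"
  by (simp add: S_symbol_def)

lemma hermitian_inv_sym: "hermitian inv_sym"
  by (simp add: hermitian_def inv_sym_def S_minus del: split_paired_All)

lemma hermitian_dx_sym: "hermitian dx_sym"
  unfolding hermitian_def
proof
  show "dx_sym (- k) = cnj (dx_sym k)" for k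
    using S_minus[of k] by (cases k) (simp add: dx_sym_def)
qed

lemma hermitian_dt_sym: "hermitian dt_sym"
  unfolding hermitian_def
proof
  show "dt_sym (- k) = cnj (dt_sym k)" for k
    using S_minus[of k] by (cases k) (simp add: dt_sym_def)
qed

lemma S_inv_multiplier:
  "S_inv \<nu> f c (fcoeff v) = multiplier inv_sym v"
  "S_inv_d_x \<nu> f c v = multiplier dx_sym v"
  "S_inv_d_theta \<nu> f c v = multiplier dt_sym v"
  unfolding S_inv_d_x_def S_inv_d_theta_def S_inv_def multiplier_def
  by (intro arg_cong[of _ _ fourier_sum] ext;
      simp add: inv_sym_def dx_sym_def dt_sym_def d_x_def d_theta_def split_beta)+

text \<open>For large \<open>k1\<close> the quartic term dominates; for bounded \<open>k1\<close> and large \<open>k2\<close> the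
  imaginary part \<open>f k2\<close> does.  Hence the symbols of \<open>S\<^sub>c\<^sup>-\<^sup>1\<close> and \<open>S\<^sub>c\<^sup>-\<^sup>1\<partial>\<^sub>x\<close> tend to zero, which is
  the source of compactness.  The symbol of \<open>S\<^sub>c\<^sup>-\<^sup>1\<partial>\<^sub>\<theta>\<close> is bounded but does not tend to
  zero.\<close>

lemma symbol_growth:
  fixes C :: real
  assumes C: "0 \<le> C"
  obtains n :: int where "\<And>k1 k2. n < \<bar>k1\<bar> \<or> n < \<bar>k2\<bar> \<Longrightarrow> C * (1 + \<bar>of_int k1\<bar>) \<le> cmod (S (k1, k2))"
proof -
  \<comment> \<open>Above \<open>t\<close> the quartic term absorbs \<open>k1\<^sup>2\<close>, \<open>c\<close> and \<open>C (1 + \<bar>k1\<bar>)\<close>.\<close>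
  define t where "t = 1 + (1 + \<bar>c\<bar> + 2 * C) / \<nu>"
  have t: "1 \<le> t" "1 + \<bar>c\<bar> + 2 * C \<le> \<nu> * t"
    using \<nu> C by (auto simp: t_def field_simps)
  define n where "n = \<lceil>max t (C * (1 + t) / f)\<rceil>"
  have "C * (1 + \<bar>of_int k1\<bar>) \<le> cmod (S (k1, k2))" if k: "n < \<bar>k1\<bar> \<or> n < \<bar>k2\<bar>" for k1 k2
  proof (cases "t \<le> \<bar>real_of_int k1\<bar>")
    case True
    define x where "x = \<bar>real_of_int k1\<bar>"
    have x1: "1 \<le> x" using True t by (simp add: x_def)
    have xx: "x \<le> x\<^sup>2" using x1 by (simp add: power2_eq_square)
    have "1 + \<bar>c\<bar> + 2 * C \<le> \<nu> * t" by (rule t(2))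
    also have "\<dots> \<le> \<nu> * x" using True \<nu> by (simp add: x_def)
    also have "\<dots> \<le> \<nu> * x\<^sup>2" using xx \<nu> by simp
    finally have "(1 + \<bar>c\<bar> + 2 * C) * x\<^sup>2 \<le> (\<nu> * x\<^sup>2) * x\<^sup>2" by (rule mult_right_mono) simp
    then have "x\<^sup>2 + \<bar>c\<bar> * x\<^sup>2 + 2 * (C * x\<^sup>2) \<le> \<nu> * x ^ 4"
      by (simp add: algebra_simps flip: power_add)
    moreover have "\<bar>c\<bar> * 1 \<le> \<bar>c\<bar> * x\<^sup>2" using x1 by (intro mult_left_mono) auto
    moreover have "C * (1 + x) \<le> C * (2 * x\<^sup>2)" using x1 xx C by (intro mult_left_mono) auto
    ultimately have "C * (1 + x) \<le> \<nu> * x ^ 4 - x\<^sup>2 + c" by linarith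
    also have "\<dots> = Re (S (k1, k2))"
      by (simp add: x_def S_symbol_def power_even_abs)
    also have "\<dots> \<le> cmod (S (k1, k2))" by (rule complex_Re_le_cmod)
    finally show ?thesis by (simp add: x_def)
  next
    case False
    have nt: "max t (C * (1 + t) / f) \<le> real_of_int n" unfolding n_def by (rule le_of_int_ceiling)
    then have "\<not> n < \<bar>k1\<bar>" using False by (simp add: not_less) linarith
    then have "n < \<bar>k2\<bar>" using k by blast
    then have "C * (1 + t) / f \<le> \<bar>real_of_int k2\<bar>" using nt by simp linarith
    then have "C * (1 + t) \<le> \<bar>Im (S (k1, k2))\<bar>"
      using f by (simp add: S_symbol_def abs_mult field_simps)
    also have "\<dots> \<le> cmod (S (k1, k2))" by (rule abs_Im_le_cmod)
    finally have "C * (1 + t) \<le> cmod (S (k1, k2))" .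
    moreover have "C * (1 + \<bar>real_of_int k1\<bar>) \<le> C * (1 + t)"
      using False C by (intro mult_left_mono) auto
    ultimately show ?thesis by simp
  qed
  then show thesis by (rule that)
qed

lemma symbol_ratio:
  assumes C: "0 < C" and le: "C * (1 + \<bar>of_int k1\<bar>) \<le> cmod (S (k1, k2))"
  shows "abs1 (inv_sym (k1, k2)) \<le> 2 / C" and "abs1 (dx_sym (k1, k2)) \<le> 2 / C"
proof -
  have pos: "0 < cmod (S (k1, k2))" using S_nonzero by simp
  have "C \<le> C * (1 + \<bar>real_of_int k1\<bar>)" "C * \<bar>real_of_int k1\<bar> \<le> C * (1 + \<bar>real_of_int k1\<bar>)"
    using C by (simp_all add: algebra_simps)
  then have "C \<le> cmod (S (k1, k2))" "C * \<bar>real_of_int k1\<bar> \<le> cmod (S (k1, k2))"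
    using le by simp_all
  then have "cmod (inv_sym (k1, k2)) \<le> 1 / C" "cmod (dx_sym (k1, k2)) \<le> 1 / C"
    using pos C by (simp_all add: inv_sym_def dx_sym_def norm_divide norm_mult field_simps)
  then show "abs1 (inv_sym (k1, k2)) \<le> 2 / C" "abs1 (dx_sym (k1, k2)) \<le> 2 / C"
    using abs1_le_cmod[of "inv_sym (k1, k2)"] abs1_le_cmod[of "dx_sym (k1, k2)"] by simp_all
qed

text \<open>The box is symmetric in both variables, so cutting a symbol at it preserves the Hermitian
  symmetry and the parity in \<open>k1\<close>.\<close>

definition mode_box :: "int \<Rightarrow> (int \<times> int) set" where "mode_box n = {- n..n} \<times> {- n..n}"

lemma finite_box: "finite (mode_box n)"
  by (simp add: mode_box_def)

lemma box_minus: "- k \<in> mode_box n \<longleftrightarrow> k \<in> mode_box n"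
  by (cases k) (auto simp: mode_box_def)

lemma box_flip: "(- k1, k2) \<in> mode_box n \<longleftrightarrow> (k1, k2) \<in> mode_box n"
  by (auto simp: mode_box_def)

lemma not_in_box: "(k1, k2) \<notin> mode_box n \<Longrightarrow> n < \<bar>k1\<bar> \<or> n < \<bar>k2\<bar>"
  by (auto simp: mode_box_def)

text \<open>Outside a finite box the growth estimate with \<open>C = 1\<close> applies; the sum over the box bounds
  the remaining values.\<close>

lemma symbols_bounded:
  obtains K where "\<And>k. abs1 (inv_sym k) \<le> K" "\<And>k. abs1 (dx_sym k) \<le> K"
proof -
  obtain n where n: "\<And>k1 k2. n < \<bar>k1\<bar> \<or> n < \<bar>k2\<bar> \<Longrightarrow> 1 * (1 + \<bar>of_int k1\<bar>) \<le> cmod (S (k1, k2))"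
    using symbol_growth[of 1] by auto
  define K where "K = 2 + (\<Sum>k\<in>mode_box n. abs1 (inv_sym k) + abs1 (dx_sym k))"
  have "abs1 (inv_sym k) + abs1 (dx_sym k) \<le> K" if "k \<in> mode_box n" for k
  proof -
    have "abs1 (inv_sym k) + abs1 (dx_sym k) \<le> (\<Sum>k\<in>mode_box n. abs1 (inv_sym k) + abs1 (dx_sym k))"
      by (rule member_le_sum[OF that _ finite_box]) simp
    then show ?thesis by (simp add: K_def)
  qed
  moreover have "0 \<le> (\<Sum>k\<in>mode_box n. abs1 (inv_sym k) + abs1 (dx_sym k))"
    by (intro sum_nonneg) simp
  moreover have "abs1 (inv_sym k) \<le> 2 \<and> abs1 (dx_sym k) \<le> 2" if "k \<notin> mode_box n" for k
    using symbol_ratio[OF _ n[OF not_in_box]] that by (cases k) simp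
  moreover note abs1_nonneg
  ultimately have "abs1 (inv_sym k) \<le> K \<and> abs1 (dx_sym k) \<le> K" for k
    by (smt (verit) K_def)
  then show thesis using that by blast
qed

lemma dt_sym_bounded: "abs1 (dt_sym k) \<le> 2 / f"
proof -
  obtain k1 k2 where k: "k = (k1, k2)" by (cases k)
  have pos: "0 < cmod (S (k1, k2))" using S_nonzero by simp
  have "f * \<bar>of_int k2\<bar> = \<bar>Im (S (k1, k2))\<bar>" using f by (simp add: S_symbol_def abs_mult)
  also have "\<dots> \<le> cmod (S (k1, k2))" by (rule abs_Im_le_cmod)
  finally have "cmod (dt_sym k) \<le> 1 / f"
    using pos f by (simp add: k dt_sym_def norm_divide norm_mult field_simps)
  then show ?thesis using abs1_le_cmod[of "dt_sym k"] by simp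
qed

section \<open>Splitting off finitely many modes\<close>

definition low :: "int \<Rightarrow> coeffs \<Rightarrow> coeffs" where "low n m k = (if k \<in> mode_box n then m k else 0)"
definition high :: "int \<Rightarrow> coeffs \<Rightarrow> coeffs" where "high n m k = (if k \<in> mode_box n then 0 else m k)"

lemma low_high:
  assumes "hermitian m" "\<And>k. abs1 (m k) \<le> K"
  shows "hermitian (low n m)" "\<And>k. abs1 (low n m k) \<le> K"
    and "hermitian (high n m)" "\<And>k. abs1 (high n m k) \<le> K"
proof -
  have "0 \<le> K" using order_trans[OF abs1_nonneg assms(2)] .
  then show "abs1 (low n m k) \<le> K" "abs1 (high n m k) \<le> K" for k
    using assms(2) by (simp_all add: low_def high_def)
  show "hermitian (low n m)" "hermitian (high n m)"
    using assms(1) by (simp_all add: hermitian_def low_def high_def box_minus del: split_paired_All)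
qed

lemma multiplier_split:
  assumes m: "hermitian m" "\<And>k. abs1 (m k) \<le> K" and v: "v \<in> X"
  shows "multiplier m v = multiplier (low n m) v + multiplier (high n m) v"
proof (rule XM_eqI)
  note a = multiplier[OF m v]
  note lo = multiplier[OF low_high(1,2)[OF m] v, of n]
  note hi = multiplier[OF low_high(3,4)[OF m] v, of n]
  show "multiplier m v \<in> X" by (rule a(1))
  show "multiplier (low n m) v + multiplier (high n m) v \<in> X" by (rule XM_add(1)[OF lo(1) hi(1)])
  show "fcoeff (multiplier m v) = fcoeff (multiplier (low n m) v + multiplier (high n m) v)"
    unfolding XM_add(2)[OF lo(1) hi(1)] a(2) lo(2) hi(2) by (auto simp: low_def high_def)
qed

lemma sum_fun_apply: "(\<Sum>i\<in>I. g i) x = (\<Sum>i\<in>I. g i x)"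
  by (induction I rule: infinite_finite_induct) simp_all

definition real_modes :: "int \<Rightarrow> tfun set"
  where "real_modes n = (\<lambda>k p. Re (mode k p)) ` mode_box n \<union> (\<lambda>k p. Im (mode k p)) ` mode_box n"

lemma multiplier_low_in_span: "multiplier (low n m) v \<in> span (real_modes n)"
proof -
  define a where "a k = m k * fcoeff v k" for k
  have "multiplier (low n m) v =
      (\<Sum>k\<in>mode_box n. Re (a k) *\<^sub>R (\<lambda>p. Re (mode k p)) - Im (a k) *\<^sub>R (\<lambda>p. Im (mode k p)))"
  proof
    fix p
    have "multiplier (low n m) v p = Re (\<Sum>\<^sub>\<infinity>k. low n m k * fcoeff v k * mode k p)"
      by (simp add: multiplier_def fourier_sum_def)
    also have "(\<Sum>\<^sub>\<infinity>k. low n m k * fcoeff v k * mode k p) = (\<Sum>\<^sub>\<infinity>k\<in>mode_box n. a k * mode k p)"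
      by (rule infsum_cong_neutral) (auto simp: low_def a_def)
    also have "\<dots> = (\<Sum>k\<in>mode_box n. a k * mode k p)" by (rule infsum_finite[OF finite_box])
    finally show "multiplier (low n m) v p = (\<Sum>k\<in>mode_box n. Re (a k) *\<^sub>R (\<lambda>p. Re (mode k p))
        - Im (a k) *\<^sub>R (\<lambda>p. Im (mode k p))) p"
      by (simp add: sum_fun_apply scaleR_fun_def)
  qed
  also have "\<dots> \<in> span (real_modes n)"
    by (intro span_sum span_diff span_scale span_base) (auto simp: real_modes_def)
  finally show ?thesis .
qed

section \<open>The nonlinear problem\<close>

abbreviation "Z \<equiv> RXM_odd r s1 s2"
abbreviation "nrmZ \<equiv> pair_normM r s1 s2"

lemma banach_Z: "banach_subspace Z nrmZ"
  using banach_subspace_pair[OF banach_XM_odd] unfolding RXM_odd_def pair_normM_def .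

lemma subspace_XM_odd: "subspace Xodd"
  using banach_XM_odd banach_subspace.V_subspace by blast

lemma fourier_sum_fcoeff: "v \<in> X \<Longrightarrow> fourier_sum (fcoeff v) = v"
  using XM_eqI[of "fourier_sum (fcoeff v)" v] fourier_sum_XM[OF XM_D(1)] by blast

lemma multiplier_odd:
  assumes m: "hermitian m" "\<And>k. abs1 (m k) \<le> K"
    and flip: "\<And>k1 k2. m (- k1, k2) = of_real t * m (k1, k2)"
    and v: "v \<in> X" "has_parity s v" and ts: "t * s = -1"
  shows "multiplier m v \<in> Xodd"
  using multiplier(1)[OF m v(1)] multiplier_parity[OF m v flip] ts by (simp add: XM_odd_iff)

lemma inv_sym_flip: "inv_sym (- k1, k2) = of_real 1 * inv_sym (k1, k2)"
  by (simp add: inv_sym_def S_flip)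

lemma dt_sym_flip: "dt_sym (- k1, k2) = of_real 1 * dt_sym (k1, k2)"
  by (simp add: dt_sym_def S_flip)

lemma dx_sym_flip: "dx_sym (- k1, k2) = of_real (-1) * dx_sym (k1, k2)"
  by (simp add: dx_sym_def S_flip)

lemma high_flip:
  "(\<And>k1 k2. m (- k1, k2) = of_real t * m (k1, k2)) \<Longrightarrow> high n m (- k1, k2) = of_real t * high n m (k1, k2)"
  by (simp add: high_def box_flip)

lemma XM_odd_mult:
  assumes "u \<in> Xodd" "v \<in> Xodd"
  shows "u * v \<in> X" "has_parity 1 (u * v)"
  using assms XM_mult(1) by (auto simp: XM_odd_iff has_parity_def)

text \<open>The error \<open>e\<close> involves fourth derivatives of \<open>u\<close> and is only a coefficient family.  But
  \<open>f \<partial>\<^sub>\<theta> + L = S\<^sub>c - c\<close>, so \<open>S\<^sub>c\<^sup>-\<^sup>1 e = u - c S\<^sub>c\<^sup>-\<^sup>1 u + S\<^sub>c\<^sup>-\<^sup>1\<partial>\<^sub>x (u\<^sup>2) / 2\<close>, which lies in the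
  space.\<close>

lemma e_tilde_in_Z:
  assumes u: "u \<in> Xodd"
  shows "e_tilde \<nu> f c u \<in> Z"
proof -
  obtain K where K: "\<And>k. abs1 (inv_sym k) \<le> K" "\<And>k. abs1 (dx_sym k) \<le> K"
    using symbols_bounded by blast
  have uX: "u \<in> X" using u by (simp add: XM_odd_iff)
  note uu = XM_odd_mult[OF u u]
  note mi = multiplier[OF hermitian_inv_sym K(1) uX]
  note mx = multiplier[OF hermitian_dx_sym K(2) uu(1)]
  define y where "y = u - c *\<^sub>R multiplier inv_sym u + (1/2) *\<^sub>R multiplier dx_sym (u * u)"
  have y: "y \<in> Xodd"
    unfolding y_def using multiplier_odd[OF hermitian_inv_sym K(1) inv_sym_flip uX, of "-1"]
      multiplier_odd[OF hermitian_dx_sym K(2) dx_sym_flip uu] u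
    by (intro subspace_add subspace_diff subspace_scale subspace_XM_odd) (simp_all add: XM_odd_iff)
  have yX: "y \<in> X" using y by (simp add: XM_odd_iff)
  have fy: "fcoeff y k = fcoeff u k - c *\<^sub>R (inv_sym k * fcoeff u k)
      + (1/2) *\<^sub>R (dx_sym k * fcoeff (u * u) k)" for k
  proof -
    note ci = XM_scaleR[OF mi(1), of c]
    note d = XM_diff[OF uX ci(1)]
    note hx = XM_scaleR[OF mx(1), of "1/2"]
    show ?thesis
      unfolding y_def XM_add(2)[OF d(1) hx(1)] d(2) ci(2) hx(2) mi(2) mx(2) ..
  qed
  have "(\<lambda>k. ks_error \<nu> f u k / S k) = fcoeff y"
  proof
    fix k :: "int \<times> int"
    obtain k1 k2 where k: "k = (k1, k2)" by (cases k)
    have "ks_error \<nu> f u k = (S k - of_real c) * fcoeff u k + (1/2) * (\<i> * of_int k1) * fcoeff (u * u) k"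
      by (simp add: k ks_error_def L_op_def d_x_def d_theta_def S_symbol_def scaleR_fun_def
          scaleR_conv_of_real algebra_simps power2_eq_square power4_eq_xxxx)
    then show "ks_error \<nu> f u k / S k = fcoeff y k"
      using S_nonzero[of k]
      by (simp add: fy k inv_sym_def dx_sym_def scaleR_conv_of_real field_simps)
  qed
  then have "S_inv \<nu> f c (ks_error \<nu> f u) = y"
    unfolding S_inv_def using fourier_sum_fcoeff[OF yX] by simp
  then show ?thesis
    using subspace_neg[OF subspace_XM_odd y] by (simp add: e_tilde_def RXM_odd_def)
qed

lemma N_tilde_eq:
  assumes \<delta>: "\<delta> \<in> Xodd"
  shows "N_tilde \<nu> f c (\<sigma>, \<delta>) =
    (0, - ((1/2) *\<^sub>R multiplier dx_sym (\<delta> * \<delta>) + \<sigma> *\<^sub>R multiplier dt_sym \<delta>))"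
    and "N_tilde \<nu> f c (\<sigma>, \<delta>) \<in> Z"
proof -
  obtain K where K: "\<And>k. abs1 (inv_sym k) \<le> K" "\<And>k. abs1 (dx_sym k) \<le> K"
    using symbols_bounded by blast
  have \<delta>X: "\<delta> \<in> X" using \<delta> by (simp add: XM_odd_iff)
  note dd = XM_odd_mult[OF \<delta> \<delta>]
  note mt = multiplier[OF hermitian_dt_sym dt_sym_bounded \<delta>X]
  note mx = multiplier[OF hermitian_dx_sym K(2) dd(1)]
  define y where "y = (1/2) *\<^sub>R multiplier dx_sym (\<delta> * \<delta>) + \<sigma> *\<^sub>R multiplier dt_sym \<delta>"
  have y: "y \<in> Xodd"
    unfolding y_def using multiplier_odd[OF hermitian_dt_sym dt_sym_bounded dt_sym_flip \<delta>X, of "-1"]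
      multiplier_odd[OF hermitian_dx_sym K(2) dx_sym_flip dd] \<delta>
    by (intro subspace_add subspace_scale subspace_XM_odd) (simp_all add: XM_odd_iff)
  then have yX: "y \<in> X" by (simp add: XM_odd_iff)
  have "(\<lambda>k. ((1/2) *\<^sub>R d_x (fcoeff (\<delta> * \<delta>)) + \<sigma> *\<^sub>R d_theta (fcoeff \<delta>)) k / S k) = fcoeff y"
  proof
    fix k :: "int \<times> int"
    obtain k1 k2 where k: "k = (k1, k2)" by (cases k)
    note hx = XM_scaleR[OF mx(1), of "1/2"]
    note ht = XM_scaleR[OF mt(1), of \<sigma>]
    have "fcoeff y k = (1/2) *\<^sub>R (dx_sym k * fcoeff (\<delta> * \<delta>) k) + \<sigma> *\<^sub>R (dt_sym k * fcoeff \<delta> k)"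
      unfolding y_def XM_add(2)[OF hx(1) ht(1)] hx(2) ht(2) mx(2) mt(2) ..
    then show "((1/2) *\<^sub>R d_x (fcoeff (\<delta> * \<delta>)) + \<sigma> *\<^sub>R d_theta (fcoeff \<delta>)) k / S k = fcoeff y k"
      using S_nonzero[of k]
      by (simp add: k dx_sym_def dt_sym_def d_x_def d_theta_def scaleR_fun_def
          scaleR_conv_of_real field_simps)
  qed
  then have "S_inv \<nu> f c ((1/2) *\<^sub>R d_x (fcoeff (\<delta> * \<delta>)) + \<sigma> *\<^sub>R d_theta (fcoeff \<delta>)) = y"
    unfolding S_inv_def using fourier_sum_fcoeff[OF yX] by simp
  then have eq: "N_tilde \<nu> f c (\<sigma>, \<delta>) = (0, - y)" by (simp add: N_tilde_def)
  show "N_tilde \<nu> f c (\<sigma>, \<delta>) =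
    (0, - ((1/2) *\<^sub>R multiplier dx_sym (\<delta> * \<delta>) + \<sigma> *\<^sub>R multiplier dt_sym \<delta>))"
    using eq by (simp add: y_def)
  show "N_tilde \<nu> f c (\<sigma>, \<delta>) \<in> Z"
    using subspace_neg[OF subspace_XM_odd y] by (simp add: eq RXM_odd_def)
qed

text \<open>The difference of the squares factors as \<open>(\<delta> + \<delta>') (\<delta> - \<delta>')\<close>, and
  \<open>\<sigma> \<delta> - \<sigma>' \<delta>' = \<sigma> (\<delta> - \<delta>') + (\<sigma> - \<sigma>') \<delta>'\<close>.\<close>

lemma N_tilde_lipschitz:
  assumes z: "z \<in> Z" and z': "z' \<in> Z"
  shows "nrmZ (N_tilde \<nu> f c z - N_tilde \<nu> f c z') \<le>
    (op_norm X nrm (S_inv_d_theta \<nu> f c) + 1/2 * op_norm X nrm (S_inv_d_x \<nu> f c))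
      * (nrmZ z + nrmZ z') * nrmZ (z - z')"
proof -
  interpret XM: banach_subspace X nrm by (rule banach_XM)
  obtain K where K: "\<And>k. abs1 (inv_sym k) \<le> K" "\<And>k. abs1 (dx_sym k) \<le> K"
    using symbols_bounded by blast
  obtain \<sigma> \<delta> where z_eq: "z = (\<sigma>, \<delta>)" by (cases z)
  obtain \<sigma>' \<delta>' where z'_eq: "z' = (\<sigma>', \<delta>')" by (cases z')
  have o: "\<delta> \<in> Xodd" "\<delta>' \<in> Xodd" using z z' by (simp_all add: RXM_odd_def z_eq z'_eq)
  then have dX: "\<delta> \<in> X" "\<delta>' \<in> X" by (simp_all add: XM_odd_iff)
  have dm: "\<delta> - \<delta>' \<in> X" and dp: "\<delta> + \<delta>' \<in> X" using XM_diff(1) XM_add(1) dX by blast+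
  note lin_x = multiplier_add[OF hermitian_dx_sym K(2)]
  note lin_t = multiplier_add[OF hermitian_dt_sym dt_sym_bounded]
  define T where "T = multiplier dt_sym"
  define D where "D = multiplier dx_sym"
  define t where "t = op_norm X nrm T"
  define d where "d = op_norm X nrm D"
  have T_eq: "S_inv_d_theta \<nu> f c = T" and D_eq: "S_inv_d_x \<nu> f c = D"
    by (simp_all add: fun_eq_iff S_inv_multiplier T_def D_def)
  have blT: "bounded_linear_op X nrm T" and blD: "bounded_linear_op X nrm D"
    unfolding T_def D_def
    using bounded_linear_multiplier[OF hermitian_dt_sym dt_sym_bounded]
      bounded_linear_multiplier[OF hermitian_dx_sym K(2)] by simp_all
  have t0: "0 \<le> t" and d0: "0 \<le> d"
    using XM.op_norm_bounds(1)[OF blT] XM.op_norm_bounds(1)[OF blD] by (simp_all add: t_def d_def)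
  have T_le: "nrm (T v) \<le> t * nrm v" and D_le: "nrm (D v) \<le> d * nrm v" if "v \<in> X" for v
    using XM.op_norm_bounds(2)[OF blT that] XM.op_norm_bounds(2)[OF blD that] by (simp_all add: t_def d_def)
  have TX: "T v \<in> X" and DX: "D v \<in> X" if "v \<in> X" for v
    using that blT blD by (simp_all add: bounded_linear_op_def)
  have T_diff: "T (\<delta> - \<delta>') + T \<delta>' = T \<delta>"
    using lin_t[OF dm dX(2)] by (simp add: T_def)
  have prod_eq: "\<delta> * \<delta> = (\<delta> + \<delta>') * (\<delta> - \<delta>') + \<delta>' * \<delta>'"
    by (simp add: fun_eq_iff algebra_simps)
  have pm: "(\<delta> + \<delta>') * (\<delta> - \<delta>') \<in> X" "\<delta>' * \<delta>' \<in> X" using XM_mult(1) dp dm dX by blast+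
  have D_diff: "D (\<delta> * \<delta>) = D ((\<delta> + \<delta>') * (\<delta> - \<delta>')) + D (\<delta>' * \<delta>')"
    unfolding prod_eq D_def by (rule lin_x[OF pm])
  let ?p = "(1/2) *\<^sub>R D ((\<delta> + \<delta>') * (\<delta> - \<delta>'))"
  let ?q = "\<sigma> *\<^sub>R T (\<delta> - \<delta>')" and ?s = "(\<sigma> - \<sigma>') *\<^sub>R T \<delta>'"
  have mem: "?p \<in> X" "?q \<in> X" "?s \<in> X"
    using DX[OF pm(1)] TX[OF dm] TX[OF dX(2)] by (simp_all add: XM_scaleR(1))
  have pqs: "?p + (?q + ?s) \<in> X" "?q + ?s \<in> X" using mem XM_add(1) by blast+
  have "N_tilde \<nu> f c z - N_tilde \<nu> f c z' = (0, - (?p + (?q + ?s)))"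
    unfolding z_eq z'_eq N_tilde_eq(1)[OF o(1)] N_tilde_eq(1)[OF o(2)]
    unfolding T_def[symmetric] D_def[symmetric] D_diff T_diff[symmetric]
    by (simp add: algebra_simps)
  then have "nrmZ (N_tilde \<nu> f c z - N_tilde \<nu> f c z') = nrm (?p + (?q + ?s))"
    using XM.norm_minus[OF pqs(1)] by (simp add: pair_normM_def)
  also have "\<dots> \<le> nrm ?p + (nrm ?q + nrm ?s)"
    using XM.norm_triangle[OF mem(1) pqs(2)] XM.norm_triangle[OF mem(2,3)] by simp
  also have "nrm ?p \<le> (1/2) * (d * ((nrm \<delta> + nrm \<delta>') * nrm (\<delta> - \<delta>')))"
  proof -
    have "nrm ?p = (1/2) * nrm (D ((\<delta> + \<delta>') * (\<delta> - \<delta>')))"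
      using XM.norm_scale[OF DX[OF pm(1)], of "1/2"] by simp
    also have "\<dots> \<le> (1/2) * (d * nrm ((\<delta> + \<delta>') * (\<delta> - \<delta>')))"
      using D_le[OF pm(1)] by simp
    also have "\<dots> \<le> (1/2) * (d * (nrm (\<delta> + \<delta>') * nrm (\<delta> - \<delta>')))"
      using XM_mult(2)[OF dp dm] d0 by (intro mult_left_mono) auto
    also have "\<dots> \<le> (1/2) * (d * ((nrm \<delta> + nrm \<delta>') * nrm (\<delta> - \<delta>')))"
      using XM.norm_triangle[OF dX] d0 XM.norm_nonneg[OF dm]
      by (intro mult_left_mono mult_right_mono) auto
    finally show ?thesis .
  qed
  also have "nrm ?q \<le> t * (\<bar>\<sigma>\<bar> * nrm (\<delta> - \<delta>'))"
    using XM.norm_scale[OF TX[OF dm], of \<sigma>] mult_left_mono[OF T_le[OF dm], of "\<bar>\<sigma>\<bar>"]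
    by (simp add: mult_ac)
  also have "nrm ?s \<le> t * (\<bar>\<sigma> - \<sigma>'\<bar> * nrm \<delta>')"
    using XM.norm_scale[OF TX[OF dX(2)], of "\<sigma> - \<sigma>'"] mult_left_mono[OF T_le[OF dX(2)], of "\<bar>\<sigma> - \<sigma>'\<bar>"]
    by (simp add: mult_ac)
  finally have le: "nrmZ (N_tilde \<nu> f c z - N_tilde \<nu> f c z') \<le>
      1/2 * (d * ((nrm \<delta> + nrm \<delta>') * nrm (\<delta> - \<delta>')))
      + (t * (\<bar>\<sigma>\<bar> * nrm (\<delta> - \<delta>')) + t * (\<bar>\<sigma> - \<sigma>'\<bar> * nrm \<delta>'))"
    by (simp add: fun_diff_def)
  have n: "nrmZ z = \<bar>\<sigma>\<bar> + nrm \<delta>" "nrmZ z' = \<bar>\<sigma>'\<bar> + nrm \<delta>'"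
      "nrmZ (z - z') = \<bar>\<sigma> - \<sigma>'\<bar> + nrm (\<delta> - \<delta>')"
    by (simp_all add: z_eq z'_eq pair_normM_def)
  have pos: "0 \<le> nrm \<delta>" "0 \<le> nrm \<delta>'" "0 \<le> nrm (\<delta> - \<delta>')" using XM.norm_nonneg dX dm by auto
  define P where "P = (nrmZ z + nrmZ z') * nrmZ (z - z')"
  have 1: "(nrm \<delta> + nrm \<delta>') * nrm (\<delta> - \<delta>') \<le> P"
    unfolding P_def n using pos by (intro mult_mono) auto
  have "\<bar>\<sigma>\<bar> * nrm (\<delta> - \<delta>') \<le> nrmZ z * nrm (\<delta> - \<delta>')"
    unfolding n using pos by (intro mult_right_mono) auto
  moreover have "\<bar>\<sigma> - \<sigma>'\<bar> * nrm \<delta>' \<le> \<bar>\<sigma> - \<sigma>'\<bar> * nrmZ z'"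
    unfolding n using pos by (intro mult_left_mono) auto
  moreover have "nrmZ z * nrm (\<delta> - \<delta>') + \<bar>\<sigma> - \<sigma>'\<bar> * nrmZ z' \<le> P"
    unfolding P_def n using pos by (simp add: algebra_simps)
  ultimately have 2: "\<bar>\<sigma>\<bar> * nrm (\<delta> - \<delta>') + \<bar>\<sigma> - \<sigma>'\<bar> * nrm \<delta>' \<le> P" by linarith
  have "nrmZ (N_tilde \<nu> f c z - N_tilde \<nu> f c z') \<le> 1/2 * (d * P) + t * P"
    using le mult_left_mono[OF 1 d0] mult_left_mono[OF 2 t0] by (simp add: distrib_left)
  then show ?thesis
    unfolding T_eq D_eq t_def[symmetric] d_def[symmetric] P_def by (simp add: algebra_simps)
qed

text \<open>The multipliers \<open>S\<^sub>c\<^sup>-\<^sup>1\<close> and \<open>S\<^sub>c\<^sup>-\<^sup>1\<partial>\<^sub>x\<close> are cut at a large mode number.  The tail \<open>G\<close> has norm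
  at most \<open>1/2\<close>, and the rest of \<open>A - id\<close> takes values in a finite-dimensional space: the first
  component is one coordinate, \<open>\<sigma> S\<^sub>c\<^sup>-\<^sup>1\<partial>\<^sub>\<theta> u\<close> is a multiple of one function, and the cut
  multipliers produce trigonometric polynomials of bounded degree.\<close>

lemma op_A_fredholm:
  assumes u: "u \<in> Xodd" and A: "bounded_linear_op Z nrmZ (op_A \<nu> f c u)"
    and inj: "\<And>z. z \<in> Z \<Longrightarrow> op_A \<nu> f c u z = 0 \<Longrightarrow> z = 0" and y: "y \<in> Z"
  shows "\<exists>z\<in>Z. op_A \<nu> f c u z = y"
proof -
  interpret XM: banach_subspace X nrm by (rule banach_XM)
  interpret Z: banach_subspace Z nrmZ by (rule banach_Z)
  obtain K where K: "\<And>k. abs1 (inv_sym k) \<le> K" "\<And>k. abs1 (dx_sym k) \<le> K"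
    using symbols_bounded by blast
  have uX: "u \<in> X" using u by (simp add: XM_odd_iff)
  have ZD: "snd z \<in> Xodd" "snd z \<in> X" "u * snd z \<in> X" if "z \<in> Z" for z
    using that XM_mult(1)[OF uX] by (auto simp: RXM_odd_def XM_odd_iff)
  define a where "a = nrm u + \<bar>c\<bar>"
  have a0: "0 \<le> a" using XM.norm_nonneg[OF uX] by (simp add: a_def)
  \<comment> \<open>Beyond the cut both symbols are at most \<open>2 / C\<close>, and \<open>a * (2 / C) \<le> 1/2\<close>.\<close>
  define C where "C = 4 * a + 1"
  have C0: "0 < C" using a0 by (simp add: C_def)
  obtain n where n: "\<And>k1 k2. n < \<bar>k1\<bar> \<or> n < \<bar>k2\<bar> \<Longrightarrow> C * (1 + \<bar>of_int k1\<bar>) \<le> cmod (S (k1, k2))"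
    using symbol_growth[of C] C0 by auto
  let ?hi = "high n inv_sym" and ?hx = "high n dx_sym"
  have tail: "abs1 (?hi k) \<le> 2 / C" "abs1 (?hx k) \<le> 2 / C" for k
    using symbol_ratio[OF C0 n[OF not_in_box]] C0 by (cases k; simp add: high_def)+
  note herm = low_high(3)[OF hermitian_inv_sym K(1), of n] low_high(3)[OF hermitian_dx_sym K(2), of n]
  note mi = multiplier[OF herm(1) tail(1)]
  note mx = multiplier[OF herm(2) tail(2)]
  define G where "G z = (0::real, multiplier ?hx (u * snd z) - c *\<^sub>R multiplier ?hi (snd z))" for z :: "real \<times> tfun"
  show ?thesis
  proof (rule Z.fredholm_alternative[where G = G and q = "1/2"
        and S = "{(1, 0), (0, multiplier dt_sym u)} \<union> Pair 0 ` real_modes n"])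
    show "op_A \<nu> f c u z \<in> Z" if "z \<in> Z" for z
      using A that by (simp add: bounded_linear_op_def)
    show "op_A \<nu> f c u (z + z') = op_A \<nu> f c u z + op_A \<nu> f c u z'" if "z \<in> Z" "z' \<in> Z" for z z'
      using A that by (simp add: bounded_linear_op_def)
    show "op_A \<nu> f c u (b *\<^sub>R z) = b *\<^sub>R op_A \<nu> f c u z" if "z \<in> Z" for b z
      using A that by (simp add: bounded_linear_op_def)
    show "G z \<in> Z" if z: "z \<in> Z" for z
    proof -
      have "multiplier ?hx (u * snd z) \<in> Xodd"
        using multiplier_odd[OF herm(2) tail(2) high_flip[OF dx_sym_flip] XM_odd_mult[OF u ZD(1)[OF z]]]
        by simp
      moreover have "multiplier ?hi (snd z) \<in> Xodd"
        using multiplier_odd[OF herm(1) tail(1) high_flip[OF inv_sym_flip] ZD(2)[OF z], of "-1"] ZD(1)[OF z]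
        by (simp add: XM_odd_iff)
      ultimately show ?thesis
        unfolding G_def RXM_odd_def using subspace_XM_odd
        by (auto intro!: subspace_diff subspace_scale)
    qed
    show "G (z + z') = G z + G z'" if z: "z \<in> Z" and z': "z' \<in> Z" for z z'
    proof -
      have "multiplier ?hx (u * snd (z + z')) = multiplier ?hx (u * snd z) + multiplier ?hx (u * snd z')"
        using multiplier_add[OF herm(2) tail(2) ZD(3)[OF z] ZD(3)[OF z']]
        by (simp add: distrib_left)
      moreover have "multiplier ?hi (snd (z + z')) = multiplier ?hi (snd z) + multiplier ?hi (snd z')"
        using multiplier_add[OF herm(1) tail(1) ZD(2)[OF z] ZD(2)[OF z']] by simp
      ultimately show ?thesis by (simp add: G_def scaleR_add_right)
    qed
    show "G (b *\<^sub>R z) = b *\<^sub>R G z" if z: "z \<in> Z" for b z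
    proof -
      have "u * (b *\<^sub>R snd z) = b *\<^sub>R (u * snd z)" by (simp add: fun_eq_iff scaleR_fun_def)
      then have "multiplier ?hx (u * snd (b *\<^sub>R z)) = b *\<^sub>R multiplier ?hx (u * snd z)"
        using multiplier_scaleR[OF herm(2) tail(2) ZD(3)[OF z], of b] by simp
      moreover have "multiplier ?hi (snd (b *\<^sub>R z)) = b *\<^sub>R multiplier ?hi (snd z)"
        using multiplier_scaleR[OF herm(1) tail(1) ZD(2)[OF z], of b] by simp
      ultimately show ?thesis by (simp add: G_def scaleR_diff_right mult.commute)
    qed
    show "nrmZ (G z) \<le> 1/2 * nrmZ z" if z: "z \<in> Z" for z
    proof -
      have m: "multiplier ?hx (u * snd z) \<in> X" "multiplier ?hi (snd z) \<in> X"
        using mx(1)[OF ZD(3)[OF z]] mi(1)[OF ZD(2)[OF z]] by simp_all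
      have cm: "c *\<^sub>R multiplier ?hi (snd z) \<in> X" using XM_scaleR(1)[OF m(2)] .
      have s0: "0 \<le> nrm (snd z)" using XM.norm_nonneg[OF ZD(2)[OF z]] .
      have "nrmZ (G z) = nrm (multiplier ?hx (u * snd z) - c *\<^sub>R multiplier ?hi (snd z))"
        by (simp add: G_def pair_normM_def)
      also have "\<dots> \<le> nrm (multiplier ?hx (u * snd z)) + nrm (c *\<^sub>R multiplier ?hi (snd z))"
        using XM.norm_triangle[OF m(1) subspace_neg[OF subspace_XM cm]] XM.norm_minus[OF cm] by simp
      also have "nrm (multiplier ?hx (u * snd z)) \<le> 2 / C * (nrm u * nrm (snd z))"
        using mx(3)[OF ZD(3)[OF z]] XM_mult(2)[OF uX ZD(2)[OF z]] C0
        by (meson divide_nonneg_pos less_imp_le mult_left_mono order_trans zero_le_numeral)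
      also have "nrm (c *\<^sub>R multiplier ?hi (snd z)) \<le> \<bar>c\<bar> * (2 / C * nrm (snd z))"
        using XM.norm_scale[OF m(2), of c] mult_left_mono[OF mi(3)[OF ZD(2)[OF z]], of "\<bar>c\<bar>"] by simp
      finally have "nrmZ (G z) \<le> (2 / C * a) * nrm (snd z)" by (simp add: a_def algebra_simps)
      also have "\<dots> \<le> 1/2 * nrm (snd z)"
        using C0 s0 by (intro mult_right_mono) (simp_all add: C_def field_simps)
      also have "\<dots> \<le> 1/2 * nrmZ z" by (cases z) (simp add: pair_normM_def)
      finally show ?thesis by simp
    qed
    show "finite ({(1, 0), (0, multiplier dt_sym u)} \<union> Pair 0 ` real_modes n :: (real \<times> tfun) set)"
      by (simp add: real_modes_def finite_box)
    show "op_A \<nu> f c u z - z - G z \<in> span ({(1, 0), (0, multiplier dt_sym u)} \<union> Pair 0 ` real_modes n)"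
      (is "_ \<in> span ?S") if z: "z \<in> Z" for z
    proof -
      obtain \<sigma> \<delta> where z_eq: "z = (\<sigma>, \<delta>)" by (cases z)
      have \<delta>: "\<delta> \<in> X" "u * \<delta> \<in> X" using ZD[OF z] by (simp_all add: z_eq)
      define l where "l = torus_pairing \<delta> (d_theta (fcoeff u)) - \<sigma>"
      define h where "h = multiplier (low n dx_sym) (u * \<delta>) - c *\<^sub>R multiplier (low n inv_sym) \<delta>"
      have "op_A \<nu> f c u z - z - G z = l *\<^sub>R (1, 0) + \<sigma> *\<^sub>R (0, multiplier dt_sym u) + (0, h)"
        unfolding z_eq op_A_def prod.case S_inv_multiplier G_def snd_conv
          multiplier_split[OF hermitian_inv_sym K(1) \<delta>(1), of n]
          multiplier_split[OF hermitian_dx_sym K(2) \<delta>(2), of n] l_def h_def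
        by (simp add: algebra_simps)
      moreover have "(0, h) \<in> span ?S"
      proof -
        have "h \<in> span (real_modes n)"
          unfolding h_def by (intro span_diff span_scale multiplier_low_in_span)
        then have "(0::real, h) \<in> Pair 0 ` span (real_modes n)" by blast
        also have "\<dots> = span (Pair 0 ` real_modes n)"
          by (intro linear_span_image[symmetric] linearI) simp_all
        also have "\<dots> \<subseteq> span ?S" by (intro span_mono) auto
        finally show ?thesis .
      qed
      moreover have "l *\<^sub>R (1, 0) + \<sigma> *\<^sub>R (0, multiplier dt_sym u) \<in> span ?S"
        by (intro span_add span_scale span_base) simp_all
      ultimately show ?thesis using span_add by metis
    qed
  qed (use inj y in auto)
qed

end

theorem theorem3p2:
  fixes \<nu> r s1 s2 f c \<alpha> e1 e2 :: real
    and u :: "real \<times> real \<Rightarrow> real"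
    and B B_hat :: "real \<times> (real \<times> real \<Rightarrow> real) \<Rightarrow> real \<times> (real \<times> real \<Rightarrow> real)"
  assumes "\<nu> > 0" and "r \<ge> 0" and "s1 \<ge> 0" and "s2 \<ge> 0"
    and "f > 0" and "u \<in> XM_odd r s1 s2"
    and "S_invertible \<nu> f c"
    and "bounded_linear_op (RXM_odd r s1 s2) (pair_normM r s1 s2) (op_A \<nu> f c u)"
    and "\<And>z. z \<in> RXM_odd r s1 s2 \<Longrightarrow> B z = z + B_hat z"
    and "bounded_linear_op (RXM_odd r s1 s2) (pair_normM r s1 s2) B"
    and "op_norm (RXM_odd r s1 s2) (pair_normM r s1 s2)
          (\<lambda>z. B_hat (op_A_hat \<nu> f c u z) + op_A_hat \<nu> f c u z + B_hat z) = \<alpha>"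
    and "\<alpha> < 1"
    and "op_norm (RXM_odd r s1 s2) (pair_normM r s1 s2) B
          * pair_normM r s1 s2 (e_tilde \<nu> f c u) \<le> e1"
    and "op_norm (RXM_odd r s1 s2) (pair_normM r s1 s2) B
          * (op_norm (XM r s1 s2) (normM r s1 s2) (S_inv_d_theta \<nu> f c)
             + 1/2 * op_norm (XM r s1 s2) (normM r s1 s2) (S_inv_d_x \<nu> f c)) \<le> e2"
    and "(1 - \<alpha>)\<^sup>2 - 4 * e1 * e2 > 0"
  shows "let \<rho> = 1 - \<alpha> - sqrt ((1 - \<alpha>)\<^sup>2 - 4 * e1 * e2);
             E = e1 / (1 - \<alpha> - \<rho>)
         in \<exists>z\<in>RXM_odd r s1 s2.
              op_A \<nu> f c u z = e_tilde \<nu> f c u + N_tilde \<nu> f c z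
              \<and> pair_normM r s1 s2 z \<le> E"
proof -
  interpret ks_operator r s1 s2 \<nu> f c
    by unfold_locales (fact assms)+
  interpret XM: banach_subspace X nrm by (rule banach_XM)
  interpret Z: banach_subspace Z nrmZ by (rule banach_Z)
  let ?A = "op_A \<nu> f c u"
  obtain K where K: "\<And>k. abs1 (inv_sym k) \<le> K" "\<And>k. abs1 (dx_sym k) \<le> K"
    using symbols_bounded by blast
  have AZ: "?A z \<in> Z" if "z \<in> Z" for z
    using assms(8) that by (simp add: bounded_linear_op_def)
  have "B (?A z) - z = B_hat (op_A_hat \<nu> f c u z) + op_A_hat \<nu> f c u z + B_hat z" if z: "z \<in> Z" for z
  proof -
    have Ahat: "op_A_hat \<nu> f c u z \<in> Z"
      unfolding op_A_hat_def using subspace_diff[OF Z.V_subspace AZ[OF z] z] .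
    have "B (?A z) = B (op_A_hat \<nu> f c u z + z)" by (simp add: op_A_hat_def)
    also have "\<dots> = B (op_A_hat \<nu> f c u z) + B z"
      using assms(10) Ahat z by (simp add: bounded_linear_op_def)
    finally show ?thesis
      using assms(9)[OF Ahat] assms(9)[OF z] by (simp add: algebra_simps)
  qed
  then have "op_norm Z nrmZ (\<lambda>z. B (?A z) - z) = \<alpha>"
    unfolding assms(11)[symmetric] op_norm_def by (intro SUP_cong) auto
  moreover have "N_tilde \<nu> f c z \<in> Z" if "z \<in> Z" for z
    using that N_tilde_eq(2) by (cases z) (simp add: RXM_odd_def)
  moreover have "N_tilde \<nu> f c 0 = 0"
  proof -
    have z: "0 \<in> Xodd" using subspace_0[OF subspace_XM_odd] .
    have "multiplier dx_sym 0 = 0"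
      using multiplier_scaleR[OF hermitian_dx_sym K(2) XM_zero, of 0] by simp
    then show ?thesis using N_tilde_eq(1)[OF z, of 0] by (simp add: zero_prod_def)
  qed
  moreover have "0 \<le> op_norm X nrm (S_inv_d_theta \<nu> f c) + 1/2 * op_norm X nrm (S_inv_d_x \<nu> f c)"
  proof -
    have "S_inv_d_theta \<nu> f c = multiplier dt_sym" "S_inv_d_x \<nu> f c = multiplier dx_sym"
      by (simp_all add: fun_eq_iff S_inv_multiplier)
    then show ?thesis
      using XM.op_norm_bounds(1)[OF bounded_linear_multiplier[OF hermitian_dt_sym dt_sym_bounded]]
        XM.op_norm_bounds(1)[OF bounded_linear_multiplier[OF hermitian_dx_sym K(2)]] by simp
  qed
  ultimately have "\<exists>z\<in>Z. ?A z = e_tilde \<nu> f c u + N_tilde \<nu> f c z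
      \<and> nrmZ z \<le> e1 / sqrt ((1 - \<alpha>)\<^sup>2 - 4 * e1 * e2)"
    using assms(12-15) N_tilde_lipschitz e_tilde_in_Z[OF assms(6)]
  proof (intro Z.quadratic_newton_kantorovich[OF assms(8,10)])
    show "\<exists>x\<in>Z. ?A x = y" if "\<And>v. v \<in> Z \<Longrightarrow> ?A v = 0 \<Longrightarrow> v = 0" "y \<in> Z" for y
      using op_A_fredholm[OF assms(6,8)] that by blast
  qed
  then show ?thesis by (simp add: Let_def)
qed

end
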